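(* Let $\Omega\subset\mathbb{R}^N$ be a bounded regular domain, $2\le p<\infty$, $\lambda_0:\Omega\to(0,\infty)$ a function bounded away from zero and from infinity, and $g$ a continuous boundary datum on $\partial\Omega$. Let $u$ be a bounded weak solution to $$-\Delta_p u+\lambda_0(x)\chi_{\{u>0\}}(x)=0\ \text{ in }\Omega,\qquad u=g\ \text{ on }\partial\Omega,$$ let $\Omega'\Subset\Omega$ and let $x_0\in\overline{\{u>0\}}\cap\Omega'$. Then there exists a constant $\mathfrak{C}_0=\mathfrak{C}_0(N,p,\inf_\Omega\lambda_0)>0$, depending only on $N$, $p$ and $\inf_\Omega\lambda_0$, such that for all $0<r<\min\{1,\operatorname{dist}(\Omega',\partial\Omega)\}$ $$\sup_{\partial B_r(x_0)}u(x)\ \ge\ \mathfrak{C}_0\, r^{\frac{p}{p-1}}.$$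
   Context: $\Delta_p u=\operatorname{div}(|\nabla u|^{p-2}\nabla u)$ is the $p$-Laplace operator, and $\chi_A$ is the characteristic function of the set $A$. A weak solution of $-\Delta_p u+\lambda_0\chi_{\{u>0\}}=0$ in $\Omega$ is a function $u\in W^{1,p}_{\rm loc}(\Omega)$ (identified with its continuous representative) such that $\int_\Omega|\nabla u|^{p-2}\nabla u\cdot\nabla\varphi\,dx=-\int_\Omega\lambda_0(x)\chi_{\{u>0\}}(x)\varphi\,dx$ for all $\varphi\in C^1_0(\Omega)$. "Regular domain" means a domain with smooth boundary. $B_r(x_0)$ is the open ball of radius $r$ centred at $x_0$. *)

theory Defs
  imports "HOL-Analysis.Analysis"
begin

definition grad :: "(real ^ 'n \<Rightarrow> real) \<Rightarrow> real ^ 'n \<Rightarrow> real ^ 'n"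
  where "grad f x = (\<chi> i. frechet_derivative f (at x) (axis i 1))"

text \<open>Only meaningful for open \<open>U\<close>, since the derivatives are not taken relative to \<open>U\<close>.\<close>

fun Ck_on :: "nat \<Rightarrow> (real ^ 'n) set \<Rightarrow> (real ^ 'n \<Rightarrow> real) \<Rightarrow> bool" where
  "Ck_on 0 U f \<longleftrightarrow> continuous_on U f"
| "Ck_on (Suc k) U f \<longleftrightarrow>
     (\<forall>x\<in>U. f differentiable (at x)) \<and> (\<forall>i. Ck_on k U (\<lambda>x. grad f x $ i))"

text \<open>Smoothness of the boundary is expressed by local defining functions: near each boundary
  point, \<open>\<Omega>\<close> is a strict sublevel set of a smooth function without critical points, so that
  \<open>\<Omega>\<close> lies locally on one side of the smooth hypersurface \<open>{\<rho> = 0}\<close>.\<close>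

definition smooth_boundary :: "(real ^ 'n) set \<Rightarrow> bool" where
  "smooth_boundary \<Omega> \<longleftrightarrow>
     (\<forall>y\<in>frontier \<Omega>. \<exists>U \<rho>. open U \<and> y \<in> U \<and> (\<forall>k. Ck_on k U \<rho>) \<and>
        (\<forall>x\<in>U. grad \<rho> x \<noteq> 0) \<and> \<Omega> \<inter> U = {x \<in> U. \<rho> x < 0})"

definition regular_domain :: "(real ^ 'n) set \<Rightarrow> bool" where
  "regular_domain \<Omega> \<longleftrightarrow> open \<Omega> \<and> connected \<Omega> \<and> \<Omega> \<noteq> {} \<and> smooth_boundary \<Omega>"

definition compactly_contained :: "(real ^ 'n) set \<Rightarrow> (real ^ 'n) set \<Rightarrow> bool"
    (infix "\<Subset>" 50) where
  "A \<Subset> \<Omega> \<longleftrightarrow> compact (closure A) \<and> closure A \<subseteq> \<Omega>"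

text \<open>The space \<open>C\<^sup>1\<^sub>0(\<Omega>)\<close> of compactly supported \<open>C\<^sup>1\<close> functions; its members are represented by
  their extension by zero to the whole space.\<close>

definition C1_0 :: "(real ^ 'n) set \<Rightarrow> (real ^ 'n \<Rightarrow> real) set" where
  "C1_0 \<Omega> = {\<phi>. Ck_on 1 UNIV \<phi> \<and> {x. \<phi> x \<noteq> 0} \<Subset> \<Omega>}"

definition Lp_loc :: "real \<Rightarrow> (real ^ 'n) set \<Rightarrow> (real ^ 'n \<Rightarrow> 'b::euclidean_space) set" where
  "Lp_loc p \<Omega> = {f. f \<in> borel_measurable (lebesgue_on \<Omega>) \<and>
     (\<forall>K. compact K \<and> K \<subseteq> \<Omega> \<longrightarrow> set_integrable lebesgue K (\<lambda>x. norm (f x) powr p))}"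

definition weak_gradient ::
    "(real ^ 'n) set \<Rightarrow> (real ^ 'n \<Rightarrow> real) \<Rightarrow> (real ^ 'n \<Rightarrow> real ^ 'n) \<Rightarrow> bool" where
  "weak_gradient \<Omega> u G \<longleftrightarrow>
     (\<forall>\<phi>\<in>C1_0 \<Omega>. \<forall>i.
        (LINT x:\<Omega>|lebesgue. u x * grad \<phi> x $ i) = - (LINT x:\<Omega>|lebesgue. G x $ i * \<phi> x))"

text \<open>\<open>u \<in> W\<^sup>1\<^sup>,\<^sup>p\<^sub>l\<^sub>o\<^sub>c(\<Omega>)\<close> with weak gradient \<open>G\<close>, which is unique up to null sets.\<close>

definition W1p_loc_gradient ::
    "real \<Rightarrow> (real ^ 'n) set \<Rightarrow> (real ^ 'n \<Rightarrow> real) \<Rightarrow> (real ^ 'n \<Rightarrow> real ^ 'n) \<Rightarrow> bool" where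
  "W1p_loc_gradient p \<Omega> u G \<longleftrightarrow>
     u \<in> Lp_loc p \<Omega> \<and> G \<in> Lp_loc p \<Omega> \<and> weak_gradient \<Omega> u G"

text \<open>Weak solutions of \<open>- \<Delta>\<^sub>p u + lam \<chi>\<^bsub>{u > 0}\<^esub> = 0\<close> in \<open>\<Omega>\<close>; continuity says that \<open>u\<close> is the
  continuous representative. Where \<open>G x = 0\<close> the factor \<open>norm (G x) powr (p - 2)\<close> is \<open>0\<close> even
  for \<open>p = 2\<close>, which is harmless because it multiplies \<open>G x\<close>.\<close>

definition weak_solution ::
    "real \<Rightarrow> (real ^ 'n \<Rightarrow> real) \<Rightarrow> (real ^ 'n) set \<Rightarrow> (real ^ 'n \<Rightarrow> real) \<Rightarrow> bool" where
  "weak_solution p lam \<Omega> u \<longleftrightarrow>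
     continuous_on \<Omega> u \<and>
     (\<exists>G. W1p_loc_gradient p \<Omega> u G \<and>
        (\<forall>\<phi>\<in>C1_0 \<Omega>.
           (LINT x:\<Omega>|lebesgue. (norm (G x) powr (p - 2) *\<^sub>R G x) \<bullet> grad \<phi> x) =
           - (LINT x:\<Omega>|lebesgue. lam x * indicator {y\<in>\<Omega>. u y > 0} x * \<phi> x)))"

text \<open>For \<open>u \<in> W\<^sup>1\<^sup>,\<^sup>p\<^sub>l\<^sub>o\<^sub>c(\<Omega>)\<close> and continuous \<open>g\<close>, the boundary condition is understood in the
  sense that \<open>u\<close> extends continuously to the boundary with values \<open>g\<close>.\<close>

definition attains_boundary_values ::
    "(real ^ 'n) set \<Rightarrow> (real ^ 'n \<Rightarrow> real) \<Rightarrow> (real ^ 'n \<Rightarrow> real) \<Rightarrow> bool" where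
  "attains_boundary_values \<Omega> u g \<longleftrightarrow> (\<forall>y\<in>frontier \<Omega>. (u \<longlongrightarrow> g y) (at y within \<Omega>))"

end

theory Submission imports Defs begin

text \<open>Let \<open>q = p/(p - 1)\<close>. The barrier \<open>\<Phi>(x) = c|x - y|\<^sup>q\<close> has constant \<open>p\<close>-Laplacian
  \<open>m/2\<close>, \<open>m = inf \<lambda>\<^sub>0\<close>, for a suitable \<open>c = c(N, p, m)\<close>. If \<open>sup u < c r\<^sup>q\<close> on \<open>\<partial>B\<^sub>r(x\<^sub>0)\<close>, then
  \<open>u < \<Phi>\<close> there for some \<open>y\<close> close to \<open>x\<^sub>0\<close> with \<open>u(y) > 0\<close>. Where \<open>u > \<Phi>\<close> one has \<open>u > 0\<close>, hence
  \<open>\<Delta>\<^sub>p u \<ge> m\<close>, and comparison gives \<open>u \<le> \<Phi>\<close> in \<open>B\<^sub>r(x\<^sub>0)\<close>, contradicting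
  \<open>u(y) > 0 = \<Phi>(y)\<close>. Only \<open>C\<^sup>1\<close> test functions are available, so the comparison is carried out with
  mollifications of \<open>u\<close>.\<close>

subsection \<open>Continuity of translations in the mean\<close>

text \<open>The obstacle is regularity: the natural test function for comparison, the positive part
  of \<open>u - \<Phi>\<close>, has only a weak gradient. Mollifying \<open>u\<close> inside the
  test function, but not in the equation, leaves the flux of the true gradient \<open>G\<close>
  untouched, so no convergence of fluxes is required. The price is an error of the form: integral of
  (|G|^(p-1) + C) |G_h - G|, with G_h the mollified gradient. Convergence in L^1 with this weight
  suffices, and it rests on the continuity of translations in the mean. Apart from this error,
  monotonicity of the flux contradicts the slack (m - m/2) times the integral of the test function.
  That integral is bounded below independently of the mollification radius, so the error can be
  pushed below the slack; this is why the barrier has p-Laplacian m/2 instead of m. The convolution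
  estimates concern Borel functions on the whole space. The solution is brought into that form by
  extending \<open>u\<close> continuously off a ball and truncating \<open>G\<close> to it.\<close>

lemma lborel_distr_diff: "distr lborel borel (\<lambda>x. x - z) = (lborel :: 'a::euclidean_space measure)"
proof -
  have "(+) (- z) = (\<lambda>x. x - z)" by auto
  then show ?thesis using lborel_distr_plus[of "- z"] by simp
qed

lemma nn_integral_lborel_diff:
  fixes z :: "'a::euclidean_space"
  assumes [measurable]: "f \<in> borel_measurable borel"
  shows "(\<integral>\<^sup>+x. f (x - z) \<partial>lborel) = (\<integral>\<^sup>+x. f x \<partial>lborel)"
  by (subst (2) lborel_distr_diff[of z, symmetric]) (simp add: nn_integral_distr)

lemma lborel_approx_compact_open:
  fixes A :: "'a::euclidean_space set"
  assumes A: "A \<in> sets borel" "emeasure lborel A < \<infinity>" and "0 < e"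
  obtains K U where "compact K" "open U" "K \<subseteq> A" "A \<subseteq> U" "emeasure lborel (U - K) \<le> ennreal e"
proof -
  \<comment> \<open>Inner regularity is applied to a finite measure, namely Lebesgue measure
    restricted to \<open>A\<close>.\<close>
  define M where "M = density lborel (indicator A)"
  have sM: "sets M = sets borel" "emeasure M (space M) \<noteq> \<infinity>"
    and eM: "\<And>B. B \<in> sets borel \<Longrightarrow> emeasure M B = emeasure lborel (A \<inter> B)"
    using A by (auto simp: M_def emeasure_density mult_ac nn_integral_set_ennreal Int_commute
        simp flip: indicator_inter_arith)
  have "emeasure lborel A = (SUP K \<in> {K. K \<subseteq> A \<and> compact K}. emeasure M K)"
    using inner_regular[OF sM A(1)] eM[OF A(1)] by simp
  also have "\<dots> = (SUP K \<in> {K. K \<subseteq> A \<and> compact K}. emeasure lborel K)"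
    by (intro SUP_cong refl) (auto simp: eM compact_imp_closed inf_absorb2)
  finally have *: "emeasure lborel A = (SUP K \<in> {K. K \<subseteq> A \<and> compact K}. emeasure lborel K)" .
  obtain K where K: "compact K" "K \<subseteq> A" "emeasure lborel A \<le> emeasure lborel K + ennreal (e/2)"
  \<comment> \<open>Subtracting e/2 gives a strictly smaller value only if the measure is positive;
    a null set is served by the empty compact set.\<close>
  proof (cases "emeasure lborel A = 0")
    case True
    then show ?thesis using that[of "{}"] by auto
  next
    case False
    have "emeasure lborel A - ennreal (e/2) < emeasure lborel A"
      using False A(2) \<open>0 < e\<close> by (intro ennreal_between) (auto simp: zero_less_iff_neq_zero)
    then obtain K where K: "K \<subseteq> A" "compact K" "emeasure lborel A - ennreal (e/2) < emeasure lborel K"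
      unfolding * less_SUP_iff by auto
    from K(3) have "emeasure lborel A - ennreal (e/2) \<le> emeasure lborel K"
      by simp
    then show ?thesis using that[of K] K(1,2) by (simp add: ennreal_minus_le_iff add.commute)
  qed
  obtain U where U: "open U" "A \<subseteq> U" "emeasure lborel (U - A) < ennreal (e/2)"
    using outer_regular_lborel[OF A(1), of "e/2"] \<open>0 < e\<close> by auto
  have m: "K \<in> sets borel" "U \<in> sets borel"
    using K(1) U(1) by (auto intro: borel_compact)
  have "emeasure lborel K \<noteq> \<infinity>"
    using A K m emeasure_mono[of K A lborel] by (auto simp: top_unique)
  then have "emeasure lborel (A - K) = emeasure lborel A - emeasure lborel K"
    using A K m by (intro emeasure_Diff) auto
  also have "\<dots> \<le> ennreal (e/2)"
    using K(3) A(2) by (auto simp: ennreal_minus_le_iff add.commute)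
  finally have 1: "emeasure lborel (A - K) \<le> ennreal (e/2)" .
  have "emeasure lborel (U - K) \<le> emeasure lborel (U - A) + emeasure lborel (A - K)"
    using A m by (subst emeasure_Un_null_set[symmetric, of _ _ "{}"]) 
      (auto intro!: order_trans[OF emeasure_mono emeasure_subadditive])
  also have "\<dots> \<le> ennreal (e/2) + ennreal (e/2)"
    using U(3) 1 by (intro add_mono) auto
  also have "\<dots> = ennreal e" using \<open>0 < e\<close> by (simp flip: ennreal_plus)
  finally show ?thesis using that K U by blast
qed

text \<open>Induction over integrable functions: indicators, sums, dominated limits. Only the
  indicator case has content. There \<open>A\<close> is squeezed between a compact \<open>K\<close>
  and an open \<open>U\<close>, and shifts shorter than the distance from \<open>K\<close> to the
  complement of \<open>U\<close> alter the indicator only on a small set.\<close>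

lemma L1_translation_continuous:
  fixes f :: "'a::euclidean_space \<Rightarrow> 'b::{banach, second_countable_topology}"
  assumes "integrable lborel f" "0 < e"
  shows "\<exists>d>0. \<forall>z. norm z < d \<longrightarrow> (\<integral>\<^sup>+x. norm (f (x - z) - f x) \<partial>lborel) \<le> ennreal e"
proof -
  have "\<forall>e>0. \<exists>d>0. \<forall>z. norm z < d \<longrightarrow> (\<integral>\<^sup>+x. norm (f (x - z) - f x) \<partial>lborel) \<le> ennreal e"
    using assms(1)
  proof (induction rule: integrable_induct)
    case (base A c)
    show ?case
    proof safe
      fix e :: real assume "0 < e"
      \<comment> \<open>The set \<open>U - K\<close> is counted twice, once for each of x and x - z,
        hence the 2; adding 1 to \<open>norm c\<close> avoids division by zero.\<close>
      define e' where "e' = e / (2 * (norm c + 1))"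
      have "e' > 0" using \<open>0 < e\<close> by (auto simp: e'_def intro!: divide_pos_pos add_nonneg_pos)
      obtain K U where KU: "compact K" "open U" "K \<subseteq> A" "A \<subseteq> U" "emeasure lborel (U - K) \<le> ennreal e'"
        using lborel_approx_compact_open[of A e'] base \<open>e' > 0\<close> by auto
      have [measurable]: "A \<in> sets borel" "K \<in> sets borel" "U \<in> sets borel"
        using base KU by (auto intro: borel_compact)
      obtain d where d: "d > 0" "\<And>x y. x \<in> K \<Longrightarrow> y \<in> - U \<Longrightarrow> d \<le> dist x y"
        using separate_compact_closed[of K "- U"] KU that by (auto simp: Ball_def) blast
      show "\<exists>d>0. \<forall>z. norm z < d \<longrightarrow> (\<integral>\<^sup>+x. norm (indicator A (x - z) *\<^sub>R c - indicator A x *\<^sub>R c) \<partial>lborel) \<le> ennreal e"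
      proof (intro exI conjI allI impI)
        fix z :: 'a assume z: "norm z < d"
        have "(\<integral>\<^sup>+x. norm (indicator A (x - z) *\<^sub>R c - indicator A x *\<^sub>R c) \<partial>lborel)
          \<le> (\<integral>\<^sup>+x. ennreal (norm c) * (indicator (U - K) x + indicator (U - K) (x - z)) \<partial>lborel)"
        proof (intro nn_integral_mono)
          fix x
          \<comment> \<open>A point of \<open>K\<close> cannot leave \<open>U\<close> under a shift
            shorter than \<open>d\<close>, in either direction. So the two indicators differ only if
            x or x - z lies in \<open>U - K\<close>.\<close>
          have "x \<in> K \<Longrightarrow> x - z \<in> U" "x - z \<in> K \<Longrightarrow> x \<in> U"
            using d(2)[of x "x - z"] d(2)[of "x - z" x] z by (auto simp: dist_norm)
          then show "ennreal (norm (indicator A (x - z) *\<^sub>R c - indicator A x *\<^sub>R c))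
            \<le> ennreal (norm c) * (indicator (U - K) x + indicator (U - K) (x - z))"
            using KU(3,4) mult_left_mono[of 1 2 "ennreal (norm c)"]
            by (auto simp: indicator_def split: if_splits)
        qed
        also have "\<dots> = ennreal (norm c) * (emeasure lborel (U - K) + emeasure lborel (U - K))"
          using nn_integral_lborel_diff[of "indicator (U - K)" z]
          by (simp add: nn_integral_cmult nn_integral_add)
        also have "\<dots> \<le> ennreal (norm c) * (ennreal e' + ennreal e')"
          using KU(5) by (intro mult_left_mono add_mono) auto
        also have "\<dots> = ennreal (norm c * (2 * e'))"
          using \<open>e' > 0\<close> by (simp add: ennreal_mult flip: ennreal_plus)
        also have "\<dots> \<le> ennreal e"
        proof (intro ennreal_leI)
          have "norm c * (2 * e') \<le> (norm c + 1) * (2 * e')"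
            using \<open>0 < e'\<close> by (intro mult_right_mono) auto
          also have "\<dots> = e"
          proof -
            have "a * (2 * (e / (2 * a))) = e" if "a \<noteq> 0" for a :: real using that by simp
            then show ?thesis unfolding e'_def by this (use norm_ge_zero[of c] in linarith)
          qed
          finally show "norm c * (2 * e') \<le> e" .
        qed
        finally show "(\<integral>\<^sup>+x. norm (indicator A (x - z) *\<^sub>R c - indicator A x *\<^sub>R c) \<partial>lborel) \<le> ennreal e" .
      qed fact
    qed
  next
    case (add f g)
    show ?case
    proof safe
      fix e :: real assume "0 < e"
      then have e2: "e/2 > 0" by simp
      obtain d1 where d1: "d1 > 0" "\<And>z. norm z < d1 \<Longrightarrow> (\<integral>\<^sup>+x. norm (f (x - z) - f x) \<partial>lborel) \<le> ennreal (e/2)"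
        using add.IH(1) e2 by blast
      obtain d2 where d2: "d2 > 0" "\<And>z. norm z < d2 \<Longrightarrow> (\<integral>\<^sup>+x. norm (g (x - z) - g x) \<partial>lborel) \<le> ennreal (e/2)"
        using add.IH(2) e2 by blast
      have [measurable]: "f \<in> borel_measurable borel" "g \<in> borel_measurable borel"
        using add.hyps by (auto dest: borel_measurable_integrable)
      show "\<exists>d>0. \<forall>z. norm z < d \<longrightarrow> (\<integral>\<^sup>+x. norm (f (x - z) + g (x - z) - (f x + g x)) \<partial>lborel) \<le> ennreal e"
      proof (intro exI[of _ "min d1 d2"] conjI allI impI)
        fix z :: 'a assume z: "norm z < min d1 d2"
        have "(\<integral>\<^sup>+x. norm (f (x - z) + g (x - z) - (f x + g x)) \<partial>lborel)
          \<le> (\<integral>\<^sup>+x. ennreal (norm (f (x - z) - f x)) + ennreal (norm (g (x - z) - g x)) \<partial>lborel)"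
          by (intro nn_integral_mono)
            (auto simp: add_diff_add norm_triangle_ineq simp flip: ennreal_plus)
        also have "\<dots> = (\<integral>\<^sup>+x. norm (f (x - z) - f x) \<partial>lborel) + (\<integral>\<^sup>+x. norm (g (x - z) - g x) \<partial>lborel)"
          by (intro nn_integral_add) auto
        also have "\<dots> \<le> ennreal (e/2) + ennreal (e/2)"
          using d1 d2 z by (intro add_mono) auto
        also have "\<dots> = ennreal e" using \<open>0 < e\<close> by (simp flip: ennreal_plus)
        finally show "(\<integral>\<^sup>+x. norm (f (x - z) + g (x - z) - (f x + g x)) \<partial>lborel) \<le> ennreal e" .
      qed (use d1 d2 in auto)
    qed
  next
    case (lim f s)
    show ?case
    proof safe
      fix e :: real assume "0 < e"
      then have e3: "e/3 > 0" by simp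
      have [measurable]: "f \<in> borel_measurable borel" "\<And>i. s i \<in> borel_measurable borel"
        using lim.hyps by (auto dest: borel_measurable_integrable)
      \<comment> \<open>The induction rule supplies approximations bounded pointwise by twice the
        norm of \<open>f\<close>, which is the dominating function.\<close>
      have "(\<lambda>i. \<integral>\<^sup>+x. norm (f x - s i x) \<partial>lborel) \<longlonglongrightarrow> 0"
        using lim.hyps
        by (intro nn_integral_dominated_convergence_norm[where w="\<lambda>x. 2 * norm (f x)"])
          (auto simp: integrable_iff_bounded nn_integral_cmult ennreal_mult ennreal_mult_less_top)
      then have "\<forall>\<^sub>F i in sequentially. (\<integral>\<^sup>+x. norm (f x - s i x) \<partial>lborel) < ennreal (e/3)"
        using e3 by (intro order_tendstoD) auto
      then obtain i where i: "(\<integral>\<^sup>+x. norm (f x - s i x) \<partial>lborel) < ennreal (e/3)"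
        by (auto simp: eventually_sequentially)
      obtain d where d: "d > 0" "\<And>z. norm z < d \<Longrightarrow> (\<integral>\<^sup>+x. norm (s i (x - z) - s i x) \<partial>lborel) \<le> ennreal (e/3)"
        using lim.IH[of i] e3 by blast
      show "\<exists>d>0. \<forall>z. norm z < d \<longrightarrow> (\<integral>\<^sup>+x. norm (f (x - z) - f x) \<partial>lborel) \<le> ennreal e"
      proof (intro exI[of _ d] conjI allI impI)
        fix z :: 'a assume z: "norm z < d"
        have "(\<integral>\<^sup>+x. norm (f (x - z) - f x) \<partial>lborel)
          \<le> (\<integral>\<^sup>+x. ennreal (norm (f (x - z) - s i (x - z))) + (ennreal (norm (s i (x - z) - s i x)) + ennreal (norm (f x - s i x))) \<partial>lborel)"
        proof (intro nn_integral_mono)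
          fix x
          have "norm (f (x - z) - f x) \<le> norm (f (x - z) - s i (x - z)) + (norm (s i (x - z) - s i x) + norm (f x - s i x))"
            using norm_triangle_ineq[of "f (x - z) - s i (x - z)" "s i (x - z) - f x"]
              norm_triangle_ineq[of "s i (x - z) - s i x" "s i x - f x"]
            by (simp add: norm_minus_commute)
          then show "ennreal (norm (f (x - z) - f x))
            \<le> ennreal (norm (f (x - z) - s i (x - z))) + (ennreal (norm (s i (x - z) - s i x)) + ennreal (norm (f x - s i x)))"
            by (simp flip: ennreal_plus)
        qed
        also have "\<dots> = (\<integral>\<^sup>+x. norm (f (x - z) - s i (x - z)) \<partial>lborel)
            + ((\<integral>\<^sup>+x. norm (s i (x - z) - s i x) \<partial>lborel) + (\<integral>\<^sup>+x. norm (f x - s i x) \<partial>lborel))"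
          by (simp add: nn_integral_add)
        also have "(\<integral>\<^sup>+x. norm (f (x - z) - s i (x - z)) \<partial>lborel) = (\<integral>\<^sup>+x. norm (f x - s i x) \<partial>lborel)"
          by (rule nn_integral_lborel_diff[where f="\<lambda>x. ennreal (norm (f x - s i x))"]) auto
        also have "(\<integral>\<^sup>+x. norm (f x - s i x) \<partial>lborel) + ((\<integral>\<^sup>+x. norm (s i (x - z) - s i x) \<partial>lborel) + (\<integral>\<^sup>+x. norm (f x - s i x) \<partial>lborel))
            \<le> ennreal (e/3) + (ennreal (e/3) + ennreal (e/3))"
          using d(2)[OF z] i by (intro add_mono) auto
        also have "\<dots> = ennreal e" using \<open>0 < e\<close> by (simp flip: ennreal_plus)
        finally show "(\<integral>\<^sup>+x. norm (f (x - z) - f x) \<partial>lborel) \<le> ennreal e" .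
      qed fact
    qed
  qed
  then show ?thesis using assms(2) by blast
qed

subsection \<open>Functions of class \<open>C\<^sup>1\<close> and mollifiers\<close>

lemma grad_eqI:
  assumes "(f has_derivative (\<lambda>v. D \<bullet> v)) (at x)"
  shows "grad f x = D"
  using frechet_derivative_at[OF assms, symmetric] by (simp add: grad_def vec_eq_iff inner_axis)

lemma Ck_on_1_I:
  assumes "\<And>x. (f has_derivative (\<lambda>v. D x \<bullet> v)) (at x)" "continuous_on UNIV D"
  shows "Ck_on 1 UNIV f"
proof -
  have "grad f = D" using grad_eqI assms(1) by blast
  then show ?thesis using assms by (auto simp: differentiable_def intro!: continuous_intros)
qed

lemma Ck_on_1_has_derivative:
  assumes "Ck_on 1 UNIV f"
  shows "(f has_derivative (\<lambda>v. grad f x \<bullet> v)) (at x)"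
proof -
  have d: "(f has_derivative frechet_derivative f (at x)) (at x)"
    using assms by (auto simp: frechet_derivative_works)
  then interpret linear "frechet_derivative f (at x)"
    by (rule has_derivative_linear)
  have "frechet_derivative f (at x) v = grad f x \<bullet> v" for v
  proof -
    have "frechet_derivative f (at x) v = frechet_derivative f (at x) (\<Sum>i\<in>UNIV. (v $ i) *\<^sub>R axis i 1)"
      by (simp add: basis_expansion flip: scalar_mult_eq_scaleR)
    also have "\<dots> = grad f x \<bullet> v"
      by (simp add: sum scale grad_def inner_vec_def mult.commute)
    finally show ?thesis .
  qed
  then have "frechet_derivative f (at x) = (\<lambda>v. grad f x \<bullet> v)" by auto
  with d show ?thesis by simp
qed

lemma Ck_on_1_continuous_grad:
  assumes "Ck_on 1 UNIV f"
  shows "continuous_on UNIV (grad f)"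
proof -
  have "continuous_on UNIV (\<lambda>x. \<chi> i. grad f x $ i)"
    using assms by (intro continuous_on_vec_lambda) auto
  then show ?thesis by simp
qed

lemma Ck_on_1_continuous:
  "Ck_on 1 UNIV f \<Longrightarrow> continuous_on UNIV f"
  using Ck_on_1_has_derivative by (meson continuous_at_imp_continuous_on has_derivative_continuous)

lemma grad_eq_0_outside:
  assumes "x \<notin> closure {x. f x \<noteq> 0}"
  shows "grad f x = 0"
proof (rule grad_eqI)
  have "((\<lambda>x. 0) has_derivative (\<lambda>v. 0)) (at x)" by simp
  then have "(f has_derivative (\<lambda>v. 0)) (at x)"
    by (rule has_derivative_transform_within_open[of _ _ _ _ "- closure {x. f x \<noteq> 0}"])
      (use assms closure_subset[of "{x. f x \<noteq> 0}"] in auto)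
  then show "(f has_derivative (\<bullet>) 0) (at x)" by (simp add: inner_zero_left[abs_def])
qed

lemma integrable_continuous_compact_support:
  fixes f :: "'a::euclidean_space \<Rightarrow> 'b::{banach, second_countable_topology}"
  assumes "continuous_on UNIV f" "compact K" "\<And>x. x \<notin> K \<Longrightarrow> f x = 0"
  shows "integrable lborel f"
proof -
  have "integrable lborel (\<lambda>x. indicator K x *\<^sub>R f x)"
    using assms by (intro borel_integrable_compact) (auto intro: continuous_on_subset)
  also have "(\<lambda>x. indicator K x *\<^sub>R f x) = f"
    using assms(3) by (auto simp: indicator_def)
  finally show ?thesis .
qed

lemma integral_lborel_diff:
  fixes f :: "'a::euclidean_space \<Rightarrow> 'b::{banach, second_countable_topology}"
  assumes [measurable]: "f \<in> borel_measurable borel"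
  shows "(\<integral>x. f (x - z) \<partial>lborel) = (\<integral>x. f x \<partial>lborel)"
  by (subst (2) lborel_distr_diff[of z, symmetric]) (simp add: integral_distr)

lemma integrable_lborel_diff:
  fixes f :: "'a::euclidean_space \<Rightarrow> 'b::{banach, second_countable_topology}"
  assumes "integrable lborel f"
  shows "integrable lborel (\<lambda>x. f (x - z))"
proof -
  have [measurable]: "f \<in> borel_measurable borel" using assms by (auto dest: borel_measurable_integrable)
  have "integrable (distr lborel borel (\<lambda>x. x - z)) f" using assms by (simp add: lborel_distr_diff)
  then show ?thesis by (subst (asm) integrable_distr_eq) auto
qed

text \<open>Translation invariance makes the integral of every difference quotient in direction
  \<open>e\<close> vanish, and dominated convergence passes this to the derivative. The mean value
  inequality yields the dominating function.\<close>

lemma integral_derivative_compact_support: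
  fixes f :: "'a::euclidean_space \<Rightarrow> real"
  assumes f: "\<And>x. (f has_derivative (\<lambda>v. D x \<bullet> v)) (at x)" and D: "continuous_on UNIV D"
    and K: "compact K" "\<And>x. x \<notin> K \<Longrightarrow> f x = 0"
  shows "(\<integral>x. D x \<bullet> e \<partial>lborel) = 0"
proof -
  obtain b where b: "K \<subseteq> cball 0 b"
    using compact_imp_bounded[OF K(1)] by (auto simp: bounded_iff subset_iff)
  \<comment> \<open>Steps have length at most \<open>norm e\<close>, so wherever a difference
    quotient is nonzero this ball contains both of its end points.\<close>
  define B where "B = cball (0::'a) (b + norm e)"
  have cf: "continuous_on UNIV f"
    using f by (meson continuous_at_imp_continuous_on has_derivative_continuous)
  have fi: "integrable lborel f"
    using integrable_continuous_compact_support[OF cf K] .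
  have [measurable]: "f \<in> borel_measurable borel" "D \<in> borel_measurable borel"
    using cf D by (auto intro: borel_measurable_continuous_onI)
  have "bounded (D ` B)"
    using D by (intro compact_imp_bounded compact_continuous_image) (auto simp: B_def intro: continuous_on_subset)
  then obtain M where M: "\<And>x. x \<in> B \<Longrightarrow> norm (D x) \<le> M" by (auto simp: bounded_iff)
  define t where "t n = 1 / real (Suc n)" for n
  have t: "t n > 0" "t n \<le> 1" for n by (auto simp: t_def)
  define s where "s n x = (f (x + t n *\<^sub>R e) - f x) / t n" for n x
  have "(\<lambda>n. \<integral>x. s n x \<partial>lborel) \<longlonglongrightarrow> (\<integral>x. D x \<bullet> e \<partial>lborel)"
  proof (rule integral_dominated_convergence[where w="\<lambda>x. M * norm e * indicator B x"])
    show "AE x in lborel. (\<lambda>n. s n x) \<longlonglongrightarrow> D x \<bullet> e"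
    proof (rule AE_I2)
      fix x
      have "((\<lambda>h. f (x + h *\<^sub>R e)) has_derivative (\<lambda>h. D x \<bullet> (h *\<^sub>R e))) (at 0)"
        by (rule has_derivative_compose[where g=f]) (auto intro!: derivative_eq_intros f simp: f)
      then have "((\<lambda>h. f (x + h *\<^sub>R e)) has_real_derivative (D x \<bullet> e)) (at 0)"
        by (simp add: has_field_derivative_def mult_commute_abs)
      then have "(\<lambda>h. (f (x + h *\<^sub>R e) - f x) / h) \<midarrow>0\<rightarrow> D x \<bullet> e"
        by (simp add: DERIV_def)
      moreover have "filterlim t (at 0) sequentially"
        unfolding t_def filterlim_at
        using LIMSEQ_inverse_real_of_nat by (auto simp: inverse_eq_divide)
      ultimately show "(\<lambda>n. s n x) \<longlonglongrightarrow> D x \<bullet> e"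
        unfolding s_def by (rule filterlim_compose)
    qed
    show "AE x in lborel. norm (s n x) \<le> M * norm e * indicator B x" for n
    proof (rule AE_I2)
      fix x
      have nt: "norm (t n *\<^sub>R e) \<le> norm e" using t[of n] mult_right_mono[of "t n" 1 "norm e"] by auto
      show "norm (s n x) \<le> M * norm e * indicator B x"
      proof (cases "f x = 0 \<and> f (x + t n *\<^sub>R e) = 0")
        case True
        have "0 \<le> M" if "x \<in> B" using M[OF that] norm_ge_zero[of "D x"] by linarith
        then have "0 \<le> M * norm e * indicator B x"
          by (auto simp: indicator_def)
        then show ?thesis using True by (simp add: s_def)
      next
        case False
        then have "norm x \<le> b \<or> norm (x + t n *\<^sub>R e) \<le> b"
          using K(2) b by (fastforce simp: subset_iff)
        then have B: "x \<in> B" "x + t n *\<^sub>R e \<in> B"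
          using nt norm_triangle_ineq[of x "t n *\<^sub>R e"] norm_triangle_ineq4[of "x + t n *\<^sub>R e" "t n *\<^sub>R e"]
          by (auto simp: B_def)
        have "norm (f (x + t n *\<^sub>R e) - f x) \<le> M * norm (x + t n *\<^sub>R e - x)"
        proof (rule differentiable_bound[of B])
          show "convex B" by (simp add: B_def)
          show "(f has_derivative (\<lambda>v. D x \<bullet> v)) (at x within B)" for x
            using f by (rule has_derivative_at_withinI)
          show "onorm (\<lambda>v. D x \<bullet> v) \<le> M" if "x \<in> B" for x
          proof (rule onorm_le)
            fix v
            have "norm (D x \<bullet> v) \<le> norm (D x) * norm v" using Cauchy_Schwarz_ineq2 by simp
            also have "\<dots> \<le> M * norm v" using M[OF that] by (intro mult_right_mono) auto
            finally show "norm (D x \<bullet> v) \<le> M * norm v" .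
          qed
        qed (use B in auto)
        then have "norm (s n x) \<le> M * norm e"
          using t[of n] by (simp add: s_def field_simps)
        then show ?thesis using B by simp
      qed
    qed
    show "integrable lborel (\<lambda>x. M * norm e * indicator B x)"
      unfolding B_def by (intro integrable_mult_right integrable_real_indicator)
        (use emeasure_lborel_cball_finite in auto)
  qed (auto simp: s_def)
  moreover have "(\<integral>x. s n x \<partial>lborel) = 0" for n
    using integrable_lborel_diff[OF fi, of "- (t n *\<^sub>R e)"] integral_lborel_diff[of f "- (t n *\<^sub>R e)"] fi
    by (simp add: s_def)
  ultimately show ?thesis by (simp add: LIMSEQ_const_iff)
qed

text \<open>The function (x - y)_i times \<open>\<phi>\<close> has compact support, so its i-th
  partial derivative integrates to zero; summing the product rule over i produces the dimension.
  Since the flux of the barrier is a multiple of x - y, this is the weak form of its constant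
  p-Laplacian.\<close>

lemma integral_id_inner_grad:
  fixes \<phi> :: "real ^ 'n \<Rightarrow> real"
  assumes \<phi>: "Ck_on 1 UNIV \<phi>" and K: "compact K" "\<And>x. x \<notin> K \<Longrightarrow> \<phi> x = 0"
  shows "(\<integral>x. (x - y) \<bullet> grad \<phi> x \<partial>lborel) = - real CARD('n) * (\<integral>x. \<phi> x \<partial>lborel)"
proof -
  note d = Ck_on_1_has_derivative[OF \<phi>] and c = Ck_on_1_continuous_grad[OF \<phi>]
    and c' = Ck_on_1_continuous[OF \<phi>]
  have [simp]: "grad \<phi> x = 0" if "x \<notin> K" for x
    using grad_eq_0_outside[of x \<phi>] K that closure_minimal[of "{x. \<phi> x \<noteq> 0}" K]
    by (auto simp: compact_imp_closed)
  have i: "integrable lborel \<phi>" "integrable lborel (\<lambda>x. (x - y) $ i * grad \<phi> x $ i)" for i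
    using K by (auto intro!: integrable_continuous_compact_support[OF _ K(1)] continuous_intros c c')
  have "(\<integral>x. (x - y) $ i * grad \<phi> x $ i \<partial>lborel) = - (\<integral>x. \<phi> x \<partial>lborel)" for i
  proof -
    have "(\<integral>x. (((x - y) $ i) *\<^sub>R grad \<phi> x + \<phi> x *\<^sub>R axis i 1) \<bullet> axis i 1 \<partial>lborel) = 0"
      by (rule integral_derivative_compact_support[where f="\<lambda>x. (x - y) $ i * \<phi> x", OF _ _ K(1)])
        (auto intro!: derivative_eq_intros d continuous_intros c c' bounded_linear.has_derivative[OF bounded_linear_vec_nth]
          simp: K inner_add_left inner_axis' algebra_simps)
    then have "(\<integral>x. (x - y) $ i * grad \<phi> x $ i + \<phi> x \<partial>lborel) = 0"
      by (simp add: inner_axis inner_add_left)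
    then show ?thesis using i by simp
  qed
  then have "(\<Sum>i\<in>UNIV. \<integral>x. (x - y) $ i * grad \<phi> x $ i \<partial>lborel) = - real CARD('n) * (\<integral>x. \<phi> x \<partial>lborel)"
    by simp
  then show ?thesis using i by (simp add: inner_vec_def)
qed

text \<open>Squaring removes the kink of the positive part: at 0 the difference quotient is at most
  |h|. Both the mollifier and the comparison test function owe their \<open>C\<^sup>1\<close>
  regularity to this.\<close>

lemma has_real_derivative_pos_part_square:
  "((\<lambda>t. (max 0 t)\<^sup>2) has_real_derivative 2 * max 0 t) (at t)"
proof -
  consider "t > 0" | "t < 0" | "t = 0" by linarith
  then show ?thesis
  proof cases
    case 1
    have "((\<lambda>t. t\<^sup>2) has_real_derivative 2 * max 0 t) (at t)"
      using 1 by (auto intro!: derivative_eq_intros)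
    then show ?thesis
      by (rule has_field_derivative_transform_within_open[where S="{0<..}"]) (use 1 in auto)
  next
    case 2
    have "((\<lambda>t. 0) has_real_derivative 2 * max 0 t) (at t)"
      using 2 by (auto intro!: derivative_eq_intros)
    then show ?thesis
      by (rule has_field_derivative_transform_within_open[where S="{..<0}"]) (use 2 in auto)
  next
    case 3
    have "(\<lambda>h. (max 0 h)\<^sup>2 / h) \<midarrow>0\<rightarrow> (0::real)"
    proof (rule Lim_null_comparison)
      show "\<forall>\<^sub>F h in at 0. norm ((max 0 h)\<^sup>2 / h) \<le> \<bar>h::real\<bar>"
        by (rule always_eventually) (auto simp: max_def power2_eq_square)
    qed (auto intro!: tendsto_eq_intros)
    then show ?thesis using 3 by (simp add: DERIV_def)
  qed
qed

text \<open>The number \<open>h\<close> is a support radius. The regularity matches the class of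
  test functions, because translated and reflected kernels are inserted into the definition of the
  weak gradient.\<close>

definition mollifier :: "real \<Rightarrow> (real ^ 'n \<Rightarrow> real) \<Rightarrow> bool" where
  "mollifier h k \<longleftrightarrow>
     Ck_on 1 UNIV k \<and> (\<forall>x. 0 \<le> k x) \<and> (\<forall>x. h \<le> norm x \<longrightarrow> k x = 0) \<and> (\<integral>x. k x \<partial>lborel) = 1"

lemma mollifier_exists:
  assumes "0 < h"
  shows "\<exists>k :: real ^ 'n \<Rightarrow> real. mollifier h k"
proof -
  \<comment> \<open>A radial bump that vanishes to second order on the sphere of radius
    \<open>h\<close>, hence \<open>C\<^sup>1\<close>; \<open>D0\<close> is its gradient.\<close>
  define k0 where "k0 x = (max 0 (h\<^sup>2 - x \<bullet> x))\<^sup>2" for x :: "real ^ 'n"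
  define D0 where "D0 x = (- 4 * max 0 (h\<^sup>2 - x \<bullet> x)) *\<^sub>R x" for x :: "real ^ 'n"
  have d: "(k0 has_derivative (\<lambda>v. D0 x \<bullet> v)) (at x)" for x
    unfolding k0_def D0_def
    by (rule has_derivative_eq_rhs[OF has_derivative_compose[OF _ 
            has_real_derivative_pos_part_square[unfolded has_field_derivative_def]]])
      (auto intro!: derivative_eq_intros simp: inner_commute)
  have c: "continuous_on UNIV k0"
    unfolding k0_def by (intro continuous_intros)
  have z: "k0 x = 0" if "h \<le> norm x" for x
    using that assms by (auto simp: k0_def max_def dot_square_norm power_mono)
  have i: "integrable lborel k0"
    by (rule integrable_continuous_compact_support[OF c, of "cball 0 h"]) (auto intro: z)
  \<comment> \<open>On the ball of radius h/2 the quantity h^2 - |x|^2 is at least 3 h^2 / 4, which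
    bounds the mass of \<open>k0\<close> away from zero and permits normalisation.\<close>
  have "0 < (h\<^sup>2 * 3 / 4)\<^sup>2 * measure lborel (ball (0::real ^ 'n) (h/2))"
    using assms content_ball_pos[of "h/2" "0::real ^ 'n"] by auto
  also have "\<dots> = (\<integral>x. (h\<^sup>2 * 3 / 4)\<^sup>2 * indicator (ball (0::real ^ 'n) (h/2)) x \<partial>lborel)"
    by simp
  also have "\<dots> \<le> (\<integral>x. k0 x \<partial>lborel)"
  proof (rule integral_mono)
    show "integrable lborel (\<lambda>x. (h\<^sup>2 * 3 / 4)\<^sup>2 * indicator (ball (0::real ^ 'n) (h/2)) x)"
      by (intro integrable_mult_right integrable_real_indicator) (use emeasure_lborel_ball_finite in auto)
    show "(h\<^sup>2 * 3 / 4)\<^sup>2 * indicator (ball 0 (h/2)) x \<le> k0 x" for x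
    proof (cases "norm x < h/2")
      case True
      then have "(norm x)\<^sup>2 \<le> (h/2)\<^sup>2" by (intro power_mono) auto
      then have "h\<^sup>2 * 3 / 4 \<le> max 0 (h\<^sup>2 - x \<bullet> x)"
        by (intro max.coboundedI2) (simp add: dot_square_norm power_divide)
      then have "(h\<^sup>2 * 3 / 4)\<^sup>2 \<le> (max 0 (h\<^sup>2 - x \<bullet> x))\<^sup>2"
        by (intro power_mono) auto
      then show ?thesis using True by (simp add: k0_def)
    qed (auto simp: k0_def)
  qed (fact i)
  finally have pos: "0 < (\<integral>x. k0 x \<partial>lborel)" .
  define I where "I = (\<integral>x. k0 x \<partial>lborel)"
  have "Ck_on 1 UNIV (\<lambda>x. k0 x / I)"
  proof (rule Ck_on_1_I)
    show "((\<lambda>x. k0 x / I) has_derivative (\<lambda>v. (D0 x /\<^sub>R I) \<bullet> v)) (at x)" for x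
      using pos by (auto intro!: derivative_eq_intros d simp: I_def divide_inverse mult.commute)
    show "continuous_on UNIV (\<lambda>x. D0 x /\<^sub>R I)" unfolding D0_def by (intro continuous_intros)
  qed
  moreover have "0 \<le> k0 x / I" for x using pos by (simp add: I_def k0_def)
  ultimately have "mollifier h (\<lambda>x. k0 x / I)"
    unfolding mollifier_def using pos i z by (simp add: I_def)
  then show ?thesis by (rule exI[of "mollifier h"])
qed

subsection \<open>Convolution\<close>

definition convol :: "('a::euclidean_space \<Rightarrow> real) \<Rightarrow> ('a \<Rightarrow> 'b::{banach, second_countable_topology}) \<Rightarrow> 'a \<Rightarrow> 'b" where
  "convol k f x = (\<integral>y. k (x - y) *\<^sub>R f y \<partial>lborel)"

lemma lborel_distr_reflect:
  "distr lborel borel (\<lambda>y. x - y) = (lborel :: 'a::euclidean_space measure)"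
  using lborel_affine[of "-1" x] by (simp add: density_1)

lemma convol_commute:
  assumes [measurable]: "k \<in> borel_measurable borel" "f \<in> borel_measurable borel"
  shows "convol k f x = (\<integral>z. k z *\<^sub>R f (x - z) \<partial>lborel)"
  unfolding convol_def
  by (subst (2) lborel_distr_reflect[of x, symmetric]) (simp add: integral_distr)

lemma
  assumes "mollifier h k"
  shows mollifier_continuous: "continuous_on UNIV k"
    and mollifier_continuous_grad: "continuous_on UNIV (grad k)"
    and mollifier_has_derivative: "(k has_derivative (\<lambda>v. grad k x \<bullet> v)) (at x)"
    and mollifier_nonneg: "0 \<le> k x"
    and mollifier_eq_0: "h \<le> norm x \<Longrightarrow> k x = 0"
    and mollifier_grad_eq_0: "h < norm x \<Longrightarrow> grad k x = 0"
    and mollifier_integrable: "integrable lborel k"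
    and mollifier_integral: "(\<integral>x. k x \<partial>lborel) = 1"
    and mollifier_measurable: "k \<in> borel_measurable borel"
    and mollifier_nn_integral: "(\<integral>\<^sup>+x. k x \<partial>lborel) = 1"
proof -
  have m: "Ck_on 1 UNIV k" "\<And>x. 0 \<le> k x" "\<And>x. h \<le> norm x \<Longrightarrow> k x = 0" "(\<integral>x. k x \<partial>lborel) = 1"
    using assms by (auto simp: mollifier_def)
  show c: "continuous_on UNIV k" "continuous_on UNIV (grad k)" "(k has_derivative (\<lambda>v. grad k x \<bullet> v)) (at x)"
    using m(1) by (rule Ck_on_1_continuous Ck_on_1_continuous_grad Ck_on_1_has_derivative)+
  show "0 \<le> k x" "h \<le> norm x \<Longrightarrow> k x = 0" "(\<integral>x. k x \<partial>lborel) = 1" by (fact m)+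
  have "{x. k x \<noteq> 0} \<subseteq> cball 0 h" using m(3) by force
  then have "closure {x. k x \<noteq> 0} \<subseteq> cball 0 h" by (intro closure_minimal) auto
  then show "h < norm x \<Longrightarrow> grad k x = 0" by (intro grad_eq_0_outside) auto
  show i: "integrable lborel k"
    by (rule integrable_continuous_compact_support[OF c(1), of "cball 0 h"]) (auto intro: m)
  show "k \<in> borel_measurable borel" using c(1) by (rule borel_measurable_continuous_onI)
  show "(\<integral>\<^sup>+x. k x \<partial>lborel) = 1"
    using i m by (subst nn_integral_eq_integral) auto
qed

text \<open>As \<open>k\<close> has mass 1, \<open>f x\<close> is its own average, so the
  mollification error is at most an average of translation errors. The bound is a nonnegative
  integral so that Tonelli can be applied to it later.\<close>

lemma norm_convol_diff_le:
  fixes f :: "real ^ 'n \<Rightarrow> 'b::{banach, second_countable_topology}"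
  assumes k: "mollifier h k" and f: "integrable lborel (\<lambda>z. k z *\<^sub>R f (x - z))"
    and [measurable]: "f \<in> borel_measurable borel"
  shows "ennreal (norm (convol k f x - f x)) \<le> (\<integral>\<^sup>+z. ennreal (k z) * norm (f (x - z) - f x) \<partial>lborel)"
proof -
  note [measurable] = mollifier_measurable[OF k]
  have i: "integrable lborel (\<lambda>z. k z *\<^sub>R f x)"
    using mollifier_integrable[OF k] by auto
  have "convol k f x - f x = (\<integral>z. k z *\<^sub>R f (x - z) \<partial>lborel) - (\<integral>z. k z *\<^sub>R f x \<partial>lborel)"
    using mollifier_integrable[OF k] mollifier_integral[OF k] by (simp add: convol_commute)
  also have "\<dots> = (\<integral>z. k z *\<^sub>R (f (x - z) - f x) \<partial>lborel)"
    using f i by (simp add: scaleR_diff_right)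
  finally have "ennreal (norm (convol k f x - f x)) \<le> (\<integral>\<^sup>+z. norm (k z *\<^sub>R (f (x - z) - f x)) \<partial>lborel)"
    using f i by (simp only:) (auto intro!: integral_norm_bound_ennreal simp: scaleR_diff_right
      simp del: Bochner_Integration.integral_diff)
  then show ?thesis
    using mollifier_nonneg[OF k] by (simp add: ennreal_mult)
qed

lemma convol_uniform_approx:
  fixes u :: "real ^ 'n \<Rightarrow> real"
  assumes u: "continuous_on UNIV u" and S: "bounded S" and "0 < e"
  shows "\<exists>d>0. \<forall>h k. h \<le> d \<longrightarrow> mollifier h k \<longrightarrow> (\<forall>x\<in>S. \<bar>convol k u x - u x\<bar> \<le> e)"
proof -
  obtain b where b: "\<And>x. x \<in> S \<Longrightarrow> norm x \<le> b" using S by (auto simp: bounded_iff)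
  \<comment> \<open>The margin 1 keeps x - z in this ball once the mollification radius is at most
    1.\<close>
  have "uniformly_continuous_on (cball 0 (b + 1)) u"
    using u by (intro compact_uniformly_continuous) (auto intro: continuous_on_subset)
  then obtain d where d: "d > 0"
    "\<And>x x'. x \<in> cball 0 (b + 1) \<Longrightarrow> x' \<in> cball 0 (b + 1) \<Longrightarrow> dist x' x < d \<Longrightarrow> dist (u x') (u x) < e"
    using \<open>0 < e\<close> unfolding uniformly_continuous_on_def by metis
  show ?thesis
  proof (intro exI conjI allI impI ballI)
    fix h x and k :: "real ^ 'n \<Rightarrow> real"
    assume h: "h \<le> min d 1" and k: "mollifier h k" and x: "x \<in> S"
    have [measurable]: "u \<in> borel_measurable borel" using u by (rule borel_measurable_continuous_onI)
    have "ennreal \<bar>convol k u x - u x\<bar> \<le> (\<integral>\<^sup>+z. ennreal (k z) * norm (u (x - z) - u x) \<partial>lborel)"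
      unfolding real_norm_def[symmetric]
    proof (rule norm_convol_diff_le[OF k])
      show "integrable lborel (\<lambda>z. k z *\<^sub>R u (x - z))"
        by (rule integrable_continuous_compact_support[of _ "cball 0 h"])
          (auto intro!: continuous_intros mollifier_continuous[OF k] mollifier_eq_0[OF k] continuous_on_compose2[OF u])
    qed auto
    also have "\<dots> \<le> (\<integral>\<^sup>+z. ennreal e * ennreal (k z) \<partial>lborel)"
    proof (rule nn_integral_mono)
      fix z
      show "ennreal (k z) * norm (u (x - z) - u x) \<le> ennreal e * ennreal (k z)"
      proof (cases "norm z < h")
        case True
        then have "dist (u (x - z)) (u x) < e"
          using h b[OF x] norm_triangle_ineq4[of x z] by (intro d) (auto simp: dist_norm norm_minus_commute)
        then have "ennreal (k z) * norm (u (x - z) - u x) \<le> ennreal (k z) * ennreal e"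
          by (intro mult_left_mono ennreal_leI) (auto simp: dist_norm)
        then show ?thesis by (simp add: mult.commute)
      qed (simp add: mollifier_eq_0[OF k])
    qed
    also have "\<dots> = ennreal e"
      using mollifier_nn_integral[OF k] mollifier_measurable[OF k] by (simp add: nn_integral_cmult)
    finally show "\<bar>convol k u x - u x\<bar> \<le> e" using \<open>0 < e\<close> by simp
  qed (use d in auto)
qed

text \<open>Along a convergent sequence all translated kernels live in one common ball, so dominated
  convergence applies. With the gradient of a mollifier as kernel this makes mollifications
  continuously differentiable.\<close>

lemma continuous_on_integral_kernel:
  fixes \<kappa> :: "'a::euclidean_space \<Rightarrow> 'b::{banach, second_countable_topology}" and u :: "'a \<Rightarrow> real"
  assumes \<kappa>: "continuous_on UNIV \<kappa>" "\<And>x. h < norm x \<Longrightarrow> \<kappa> x = 0" and u: "continuous_on UNIV u"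
  shows "continuous_on UNIV (\<lambda>x. \<integral>y. u y *\<^sub>R \<kappa> (x - y) \<partial>lborel)"
proof (rule continuous_at_imp_continuous_on, intro ballI, unfold continuous_at_sequentially, intro allI impI, unfold o_def)
  fix a :: 'a and X assume "X \<longlonglongrightarrow> a"
  then have "bounded (range X)" by (rule convergent_imp_bounded)
  then obtain b where b: "\<And>n. norm (X n) \<le> b" by (auto simp: bounded_iff)
  have [measurable]: "\<kappa> \<in> borel_measurable borel" "u \<in> borel_measurable borel"
    using \<kappa> u by (auto intro: borel_measurable_continuous_onI)
  have "bounded (\<kappa> ` cball 0 h)"
    using \<kappa>(1) by (intro compact_imp_bounded compact_continuous_image) (auto intro: continuous_on_subset)
  then obtain M where M: "\<And>x. norm x \<le> h \<Longrightarrow> norm (\<kappa> x) \<le> M"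
    unfolding bounded_iff by fastforce
  have M': "norm (\<kappa> x) \<le> max M 0" for x using M[of x] \<kappa>(2)[of x] by (cases "norm x \<le> h") auto
  show "(\<lambda>n. \<integral>y. u y *\<^sub>R \<kappa> (X n - y) \<partial>lborel) \<longlonglongrightarrow> (\<integral>y. u y *\<^sub>R \<kappa> (a - y) \<partial>lborel)"
  proof (rule integral_dominated_convergence[where w="\<lambda>y. max M 0 * (indicator (cball 0 (b + h)) y *\<^sub>R \<bar>u y\<bar>)"])
    show "AE y in lborel. (\<lambda>n. u y *\<^sub>R \<kappa> (X n - y)) \<longlonglongrightarrow> u y *\<^sub>R \<kappa> (a - y)"
    proof (rule AE_I2)
      fix y
      have "(\<lambda>n. \<kappa> (X n - y)) \<longlonglongrightarrow> \<kappa> (a - y)"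
        using \<kappa>(1) \<open>X \<longlonglongrightarrow> a\<close> by (intro continuous_on_tendsto_compose[of UNIV \<kappa>]) (auto intro: tendsto_intros)
      then show "(\<lambda>n. u y *\<^sub>R \<kappa> (X n - y)) \<longlonglongrightarrow> u y *\<^sub>R \<kappa> (a - y)" by (intro tendsto_intros)
    qed
    show "AE y in lborel. norm (u y *\<^sub>R \<kappa> (X n - y)) \<le> max M 0 * (indicator (cball 0 (b + h)) y *\<^sub>R \<bar>u y\<bar>)" for n
    proof (rule AE_I2)
      fix y
      show "norm (u y *\<^sub>R \<kappa> (X n - y)) \<le> max M 0 * (indicator (cball 0 (b + h)) y *\<^sub>R \<bar>u y\<bar>)"
      proof (cases "norm y \<le> b + h")
        case True
        then show ?thesis using mult_left_mono[OF M', of "\<bar>u y\<bar>" "X n - y"] by (simp add: mult.commute)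
      next
        case False
        then show ?thesis using \<kappa>(2)[of "X n - y"] b[of n] norm_triangle_ineq2[of y "X n"]
          by (simp add: norm_minus_commute)
      qed
    qed
    show "integrable lborel (\<lambda>y. max M 0 * (indicator (cball 0 (b + h)) y *\<^sub>R \<bar>u y\<bar>))"
      using u by (intro integrable_mult_right borel_integrable_compact continuous_intros) (auto intro: continuous_on_subset)
  qed auto
qed

text \<open>The derivative falls on the kernel. Uniform continuity of its gradient makes the
  first-order Taylor error of \<open>k\<close> uniformly small relative to
  \<open>norm (x - a)\<close>, and integrating against |u| over a common support keeps it
  so.\<close>

lemma has_derivative_convol:
  fixes k u :: "real ^ 'n \<Rightarrow> real"
  assumes k: "mollifier h k" and u: "continuous_on UNIV u"
  shows "(convol k u has_derivative (\<lambda>v. (\<integral>y. u y *\<^sub>R grad k (a - y) \<partial>lborel) \<bullet> v)) (at a)"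
proof -
  \<comment> \<open>For x within distance 1 of \<open>a\<close>, the kernel centred at x vanishes
    for y outside \<open>T\<close>. For y in \<open>T\<close>, the ball \<open>C\<close> contains
    the segment from a - y to x - y on which the kernel is linearised.\<close>
  define T where "T = cball a (1 + \<bar>h\<bar>)"
  define C where "C = cball (0::real ^ 'n) (2 + \<bar>h\<bar>)"
  have ck: "continuous_on A (\<lambda>y. k (x - y))" "continuous_on A (\<lambda>y. grad k (x - y))" for A x
    by (auto intro!: continuous_on_compose2[OF mollifier_continuous[OF k]]
        continuous_on_compose2[OF mollifier_continuous_grad[OF k]] continuous_intros)
  have u': "continuous_on A u" for A using u by (rule continuous_on_subset) auto
  have z: "k (x - y) = 0" "grad k (x - y) = 0" if "y \<notin> T" "norm (x - a) < 1" for x y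
  proof -
    have "h < norm (x - y)"
      using that norm_triangle_ineq4[of "x - a" "x - y"] abs_ge_self[of h]
      by (auto simp: T_def dist_norm norm_minus_commute)
    then show "k (x - y) = 0" "grad k (x - y) = 0"
      using mollifier_eq_0[OF k] mollifier_grad_eq_0[OF k] by auto
  qed
  have i: "integrable lborel (\<lambda>y. k (x - y) *\<^sub>R u y)" "integrable lborel (\<lambda>y. u y *\<^sub>R grad k (x - y))"
    if "norm (x - a) < 1" for x
    by (rule integrable_continuous_compact_support[of _ T];
        use z[OF _ that] in \<open>auto intro!: continuous_intros ck u simp: T_def\<close>)+
  have iu: "integrable lborel (\<lambda>y. indicator T y *\<^sub>R \<bar>u y\<bar>)"
    by (intro borel_integrable_compact continuous_intros u') (simp add: T_def)
  define I where "I = (\<integral>y. indicator T y *\<^sub>R \<bar>u y\<bar> \<partial>lborel)"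
  have "I \<ge> 0" unfolding I_def by (intro integral_nonneg_AE) auto
  have uc: "uniformly_continuous_on C (grad k)"
    by (intro compact_uniformly_continuous continuous_on_subset[OF mollifier_continuous_grad[OF k]]) (auto simp: C_def)
  show ?thesis
    unfolding has_derivative_at_alt
  proof (intro conjI allI impI bounded_linear_inner_right)
    fix e :: real assume "0 < e"
    define e' where "e' = e / (I + 1)"
    have "e' > 0" using \<open>0 < e\<close> \<open>I \<ge> 0\<close> by (simp add: e'_def)
    obtain d where d: "d > 0" "\<And>w w'. w \<in> C \<Longrightarrow> w' \<in> C \<Longrightarrow> dist w' w < d \<Longrightarrow> dist (grad k w') (grad k w) < e'"
      using uc \<open>e' > 0\<close> unfolding uniformly_continuous_on_def by metis
    show "\<exists>d>0. \<forall>x. norm (x - a) < d \<longrightarrow>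
       norm (convol k u x - convol k u a - (\<integral>y. u y *\<^sub>R grad k (a - y) \<partial>lborel) \<bullet> (x - a)) \<le> e * norm (x - a)"
    proof (intro exI[of _ "min d 1"] conjI allI impI)
      fix x assume x: "norm (x - a) < min d 1"
      have lin: "\<bar>k (x - y) - k (a - y) - grad k (a - y) \<bullet> (x - a)\<bar> \<le> norm (x - a) * e'" if y: "y \<in> T" for y
      proof -
        have "norm (k (x - y) - k (a - y) - grad k (a - y) \<bullet> ((x - y) - (a - y))) \<le> norm ((x - y) - (a - y)) * e'"
        proof (rule differentiable_bound_linearization[where S="C \<inter> ball (a - y) (min d 1)"
              and f'="\<lambda>w v. grad k w \<bullet> v" and ?x0.0="a - y"])
          have in_C: "a - y \<in> C" using y by (auto simp: C_def T_def dist_norm norm_minus_commute)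
          show "a - y + t *\<^sub>R (x - y - (a - y)) \<in> C \<inter> ball (a - y) (min d 1)" if "t \<in> {0..1}" for t
          proof -
            have "norm (t *\<^sub>R (x - a)) \<le> norm (x - a)" using that mult_right_mono[of t 1 "norm (x - a)"] by auto
            then show ?thesis using x y norm_triangle_ineq4[of "y - a" "t *\<^sub>R (x - a)"]
              by (auto simp: C_def T_def dist_norm norm_minus_commute[of "y - a"] norm_minus_commute[of y a])
          qed
          show "onorm ((\<bullet>) (grad k w) - (\<bullet>) (grad k (a - y))) \<le> e'" if "w \<in> C \<inter> ball (a - y) (min d 1)" for w
          proof (rule onorm_le)
            fix v :: "real ^ 'n"
            have "norm (grad k w - grad k (a - y)) \<le> e'"
              using d(2)[OF in_C, of w] that by (auto simp: dist_norm dist_commute norm_minus_commute)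
            then have "norm (grad k w - grad k (a - y)) * norm v \<le> e' * norm v"
              by (intro mult_right_mono) auto
            then show "norm (((\<bullet>) (grad k w) - (\<bullet>) (grad k (a - y))) v) \<le> e' * norm v"
              using Cauchy_Schwarz_ineq2[of "grad k w - grad k (a - y)" v] by (simp add: inner_diff_left)
          qed
          show "a - y \<in> C \<inter> ball (a - y) (min d 1)" using in_C d by auto
        qed (auto intro!: has_derivative_at_withinI mollifier_has_derivative[OF k])
        then show ?thesis by simp
      qed
      define F where "F y = u y * (k (x - y) - k (a - y) - grad k (a - y) \<bullet> (x - a))" for y
      have x1: "norm (x - a) < 1" "norm (a - a) < 1" using x by auto
      have ii: "integrable lborel (\<lambda>y. (u y *\<^sub>R grad k (a - y)) \<bullet> (x - a))"
        using i(2)[OF x1(2)] by (intro integrable_inner_left)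
      have Feq: "F = (\<lambda>y. k (x - y) *\<^sub>R u y - k (a - y) *\<^sub>R u y - (u y *\<^sub>R grad k (a - y)) \<bullet> (x - a))"
        by (auto simp: F_def algebra_simps)
      have iF: "integrable lborel F"
        unfolding Feq using i(1)[OF x1(1)] i(1)[OF x1(2)] ii by (intro Bochner_Integration.integrable_diff)
      have "convol k u x - convol k u a - (\<integral>y. u y *\<^sub>R grad k (a - y) \<partial>lborel) \<bullet> (x - a) = (\<integral>y. F y \<partial>lborel)"
        unfolding convol_def Feq using i(1)[OF x1(1)] i(1)[OF x1(2)] ii
          integral_inner_left[OF i(2)[OF x1(2)], of "x - a"]
        by (simp del: inner_scaleR_left real_scaleR_def)
      also have "norm \<dots> \<le> (\<integral>y. norm (F y) \<partial>lborel)" by (rule integral_norm_bound)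
      also have "\<dots> \<le> (\<integral>y. (norm (x - a) * e') * (indicator T y *\<^sub>R \<bar>u y\<bar>) \<partial>lborel)"
      proof (rule integral_mono)
        show "norm (F y) \<le> (norm (x - a) * e') * (indicator T y *\<^sub>R \<bar>u y\<bar>)" for y
        proof (cases "y \<in> T")
          case True
          then show ?thesis using mult_left_mono[OF lin[OF True], of "\<bar>u y\<bar>"] by (simp add: F_def abs_mult mult_ac)
        next
          case False
          then show ?thesis using z[OF False x1(1)] z[OF False x1(2)] by (simp add: F_def)
        qed
      qed (use iF iu in auto)
      also have "\<dots> = (norm (x - a) * e') * I" by (simp add: I_def)
      also have "\<dots> \<le> (norm (x - a) * e') * (I + 1)"
        using \<open>e' > 0\<close> by (intro mult_left_mono) auto
      also have "\<dots> = e * norm (x - a)" using \<open>I \<ge> 0\<close> by (simp add: e'_def)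
      finally show "norm (convol k u x - convol k u a - (\<integral>y. u y *\<^sub>R grad k (a - y) \<partial>lborel) \<bullet> (x - a)) \<le> e * norm (x - a)" .
    qed (use d in auto)
  qed
qed

lemma mollifier_bounded:
  assumes k: "mollifier h k"
  obtains M where "0 \<le> M" "\<And>z. \<bar>k z\<bar> \<le> M"
proof -
  have "bounded (k ` cball 0 h)"
    using mollifier_continuous[OF k] by (intro compact_imp_bounded compact_continuous_image) (auto intro: continuous_on_subset)
  then obtain M where M: "\<And>z. norm z \<le> h \<Longrightarrow> \<bar>k z\<bar> \<le> M" unfolding bounded_iff by fastforce
  have "\<bar>k z\<bar> \<le> max M 0" for z
    using M[of z] mollifier_eq_0[OF k, of z] by (cases "norm z \<le> h") auto
  then show ?thesis using that[of "max M 0"] by auto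
qed

text \<open>The weak gradient is tested with the reflected kernel y \<mapsto>
  \<open>k (x - y)\<close>, admissible because its support stays in \<open>U\<close>. The minus sign
  from the reflection cancels the one from integration by parts.\<close>

lemma convol_gradient:
  fixes u :: "real ^ 'n \<Rightarrow> real"
  assumes k: "mollifier h k" and u: "continuous_on UNIV u" and G: "integrable lborel G"
    and wg: "\<And>\<phi> i. \<phi> \<in> C1_0 U \<Longrightarrow> (\<integral>x. u x * grad \<phi> x $ i \<partial>lborel) = - (\<integral>x. G x $ i * \<phi> x \<partial>lborel)"
    and U: "cball x h \<subseteq> U"
  shows "(\<integral>y. u y *\<^sub>R grad k (x - y) \<partial>lborel) = convol k G x"
proof -
  define \<phi> where "\<phi> y = k (x - y)" for y
  have [measurable]: "G \<in> borel_measurable borel" "k \<in> borel_measurable borel"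
    using G mollifier_measurable[OF k] by (auto dest: borel_measurable_integrable)
  have d: "(\<phi> has_derivative (\<lambda>v. (- grad k (x - y)) \<bullet> v)) (at y)" for y
    unfolding \<phi>_def
    by (rule has_derivative_eq_rhs[OF has_derivative_compose[OF _ mollifier_has_derivative[OF k]]])
      (auto intro!: derivative_eq_intros)
  have g: "grad \<phi> y = - grad k (x - y)" for y by (rule grad_eqI[OF d])
  have c: "continuous_on UNIV (\<lambda>y. grad k (x - y))"
    by (auto intro!: continuous_on_compose2[OF mollifier_continuous_grad[OF k]] continuous_intros)
  have "{y. \<phi> y \<noteq> 0} \<subseteq> cball x h"
    using mollifier_eq_0[OF k] by (force simp: \<phi>_def dist_norm)
  then have cl: "closure {y. \<phi> y \<noteq> 0} \<subseteq> cball x h" by (intro closure_minimal) auto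
  have "\<phi> \<in> C1_0 U"
    using cl U compact_closure bounded_cball bounded_subset[OF bounded_cball, of "{y. \<phi> y \<noteq> 0}" x h] \<open>{y. \<phi> y \<noteq> 0} \<subseteq> cball x h\<close>
    by (auto simp: C1_0_def compactly_contained_def simp del: Ck_on.simps One_nat_def
        intro!: Ck_on_1_I[OF d] continuous_intros c)
  then have w: "(\<integral>y. u y * grad k (x - y) $ i \<partial>lborel) = (\<integral>y. G y $ i * k (x - y) \<partial>lborel)" for i
    using wg[of \<phi> i] by (simp add: g \<phi>_def)
  have i1: "integrable lborel (\<lambda>y. u y *\<^sub>R grad k (x - y))"
    by (rule integrable_continuous_compact_support[of _ "cball x h"])
      (auto intro!: continuous_intros c u mollifier_grad_eq_0[OF k] simp: dist_norm)
  have i2: "integrable lborel (\<lambda>y. k (x - y) *\<^sub>R G y)"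
  proof -
    obtain M where M: "0 \<le> M" "\<And>z. \<bar>k z\<bar> \<le> M" using mollifier_bounded[OF k] by blast
    show ?thesis
      by (rule Bochner_Integration.integrable_bound[of _ "\<lambda>y. M *\<^sub>R G y"])
        (use G M in \<open>auto intro!: mult_right_mono\<close>)
  qed
  show ?thesis
    unfolding vec_eq_iff
  proof
    fix i
    show "(\<integral>y. u y *\<^sub>R grad k (x - y) \<partial>lborel) $ i = convol k G x $ i"
      using integral_bounded_linear[OF bounded_linear_vec_nth i1, of i]
        integral_bounded_linear[OF bounded_linear_vec_nth i2, of i] w[of i]
      by (simp add: convol_def mult.commute)
  qed
qed

section \<open>Mollification error of the gradient in weighted L^1\<close>

text \<open>Each summand on the right becomes small after integration: the first and last are
  translation errors, the middle one is a tail. For a large \<open>a\<close>, the left side is at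
  most 2 |a|^p + |b|^p by the triangle inequality and monotonicity of powers; trading |b|^p for
  |a|^p costs the last term and gives the factor 3.\<close>

lemma powr_weighted_diff_le:
  fixes a b :: "'a::real_normed_vector"
  assumes p: "1 \<le> p" and M: "0 < M"
  shows "norm a powr (p - 1) * norm (b - a) \<le>
    M powr (p - 1) * norm (b - a) + (if M < norm a then 3 * norm a powr p else 0) + \<bar>norm b powr p - norm a powr p\<bar>"
proof (cases "M < norm a")
  case False
  then have "norm a powr (p - 1) \<le> M powr (p - 1)" using p by (intro powr_mono2) auto
  then have "norm a powr (p - 1) * norm (b - a) \<le> M powr (p - 1) * norm (b - a)"
    by (intro mult_right_mono) auto
  then show ?thesis using False by auto
next
  case True
  have eq: "t powr (p - 1) * t = t powr p" if "0 \<le> t" for t :: real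
    using that powr_mult_base[of t "p - 1"] by (simp add: mult.commute)
  have "norm a powr (p - 1) * norm (b - a) \<le> norm a powr (p - 1) * (norm b + norm a)"
    by (intro mult_left_mono norm_triangle_ineq4) auto
  also have "\<dots> = norm a powr (p - 1) * norm b + norm a powr p"
    by (simp add: eq distrib_left)
  also have "norm a powr (p - 1) * norm b \<le> norm a powr p + norm b powr p"
  proof (cases "norm a \<le> norm b")
    case True
    then have "norm a powr (p - 1) * norm b \<le> norm b powr (p - 1) * norm b"
      using p by (intro mult_right_mono powr_mono2) auto
    then show ?thesis by (simp add: eq add_increasing)
  next
    case False
    then have "norm a powr (p - 1) * norm b \<le> norm a powr (p - 1) * norm a"
      by (intro mult_left_mono) auto
    then show ?thesis by (simp add: eq add_increasing2)
  qed
  finally have *: "norm a powr (p - 1) * norm (b - a) \<le> norm a powr p + norm b powr p + norm a powr p"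
    by simp
  have "0 \<le> M powr (p - 1) * norm (b - a)" by simp
  with * have "norm a powr (p - 1) * norm (b - a)
      \<le> M powr (p - 1) * norm (b - a) + 3 * norm a powr p + \<bar>norm b powr p - norm a powr p\<bar>"
    by linarith
  then show ?thesis using True by simp
qed

text \<open>Splitting at \<open>|f| \<le> M\<close> reduces the weighted continuity of translations to the unweighted one
  for \<open>f\<close> and for \<open>|f|\<^sup>p\<close>.\<close>

lemma Lp_weighted_translation_continuous:
  fixes f :: "'a::euclidean_space \<Rightarrow> 'b::{banach, second_countable_topology}"
  assumes p: "1 \<le> p" and C: "0 \<le> C" and f: "integrable lborel f" "integrable lborel (\<lambda>x. norm (f x) powr p)"
    and e: "0 < e"
  shows "\<exists>d>0. \<forall>z. norm z < d \<longrightarrow>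
    (\<integral>\<^sup>+x. ennreal (norm (f x) powr (p - 1) + C) * norm (f (x - z) - f x) \<partial>lborel) \<le> ennreal e"
proof -
  have [measurable]: "f \<in> borel_measurable borel" using f by (auto dest: borel_measurable_integrable)
  define F where "F x = norm (f x) powr p" for x
  \<comment> \<open>The tail of \<open>F\<close> above the level n + 1: at each point it is
    eventually zero, and 3 \<open>F\<close> dominates it, so its integral tends to 0.\<close>
  define H where "H n x = (if real (Suc n) < norm (f x) then 3 * F x else 0)" for n x
  have [measurable]: "F \<in> borel_measurable borel" "H n \<in> borel_measurable borel" for n
    unfolding H_def F_def by measurable
  have "(\<lambda>n. \<integral>x. H n x \<partial>lborel) \<longlonglongrightarrow> (\<integral>x. 0 \<partial>(lborel :: 'a measure))"
  proof (rule integral_dominated_convergence[where w="\<lambda>x. 3 * F x"])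
    show "AE x in lborel. (\<lambda>n. H n x) \<longlonglongrightarrow> 0"
    proof (rule AE_I2, rule tendsto_eventually)
      fix x
      show "\<forall>\<^sub>F n in sequentially. H n x = 0"
        using eventually_gt_at_top[of "nat \<lceil>norm (f x)\<rceil>"]
        by eventually_elim (auto simp: H_def, linarith)
    qed
  qed (use f in \<open>auto simp: F_def H_def\<close>)
  then have "\<forall>\<^sub>F n in sequentially. (\<integral>x. H n x \<partial>lborel) < e / 3"
    using e by (intro order_tendstoD) auto
  then obtain n where n: "(\<integral>x. H n x \<partial>lborel) < e / 3" by (auto simp: eventually_sequentially)
  have iH: "integrable lborel (H n)"
    by (rule Bochner_Integration.integrable_bound[of _ "\<lambda>x. 3 * F x"]) (use f in \<open>auto simp: F_def H_def\<close>)
  have nH: "(\<integral>\<^sup>+x. H n x \<partial>lborel) \<le> ennreal (e / 3)"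
  proof (subst nn_integral_eq_integral[OF iH])
    show "AE x in lborel. 0 \<le> H n x" by (auto simp: H_def F_def)
  qed (use n in \<open>intro ennreal_leI less_imp_le\<close>)
  \<comment> \<open>The factor in front of the unweighted translation error. The level n is already
    fixed by the tail, so the shift may be chosen depending on \<open>L\<close>.\<close>
  define L where "L = real (Suc n) powr (p - 1) + C"
  have L: "L > 0" unfolding L_def using C by (intro add_pos_nonneg) auto
  obtain d1 where d1: "d1 > 0" "\<And>z. norm z < d1 \<Longrightarrow> (\<integral>\<^sup>+x. norm (f (x - z) - f x) \<partial>lborel) \<le> ennreal (e / (3 * L))"
    using L1_translation_continuous[OF f(1), of "e / (3 * L)"] e L by auto
  obtain d2 where d2: "d2 > 0" "\<And>z. norm z < d2 \<Longrightarrow> (\<integral>\<^sup>+x. norm (F (x - z) - F x) \<partial>lborel) \<le> ennreal (e / 3)"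
    using L1_translation_continuous[OF f(2), of "e / 3"] e unfolding F_def by auto
  show ?thesis
  proof (intro exI[of _ "min d1 d2"] conjI allI impI)
    fix z :: 'a assume z: "norm z < min d1 d2"
    have "(\<integral>\<^sup>+x. ennreal (norm (f x) powr (p - 1) + C) * norm (f (x - z) - f x) \<partial>lborel)
      \<le> (\<integral>\<^sup>+x. ennreal L * norm (f (x - z) - f x) + (ennreal (H n x) + norm (F (x - z) - F x)) \<partial>lborel)"
    proof (rule nn_integral_mono)
      fix x
      have "(norm (f x) powr (p - 1) + C) * norm (f (x - z) - f x)
        \<le> L * norm (f (x - z) - f x) + (H n x + norm (F (x - z) - F x))"
        using powr_weighted_diff_le[OF p, of "real (Suc n)" "f x" "f (x - z)"]
        by (auto simp: L_def H_def F_def algebra_simps)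
      moreover have "0 \<le> H n x" by (auto simp: H_def F_def)
      ultimately show "ennreal (norm (f x) powr (p - 1) + C) * norm (f (x - z) - f x)
        \<le> ennreal L * norm (f (x - z) - f x) + (ennreal (H n x) + norm (F (x - z) - F x))"
        using L C by (simp flip: ennreal_mult ennreal_plus add: ennreal_leI del: real_norm_def)
    qed
    also have "\<dots> = ennreal L * (\<integral>\<^sup>+x. norm (f (x - z) - f x) \<partial>lborel)
        + ((\<integral>\<^sup>+x. H n x \<partial>lborel) + (\<integral>\<^sup>+x. norm (F (x - z) - F x) \<partial>lborel))"
      by (simp add: nn_integral_add nn_integral_cmult)
    also have "\<dots> \<le> ennreal L * ennreal (e / (3 * L)) + (ennreal (e / 3) + ennreal (e / 3))"
      using d1(2)[of z] d2(2)[of z] z nH by (intro add_mono mult_left_mono) auto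
    also have "\<dots> = ennreal e"
      using e L by (simp flip: ennreal_mult ennreal_plus)
    finally show "(\<integral>\<^sup>+x. ennreal (norm (f x) powr (p - 1) + C) * norm (f (x - z) - f x) \<partial>lborel) \<le> ennreal e" .
  qed (use d1 d2 in auto)
qed

text \<open>By Tonelli the weighted mollification error is at most the average, with density
  \<open>k\<close>, of weighted translation errors over shifts shorter than \<open>h\<close>. The
  weight is the bound for the flux difference that multiplies the error in the comparison
  argument.\<close>

lemma Lp_weighted_convol_approx:
  fixes G :: "real ^ 'n \<Rightarrow> real ^ 'n"
  assumes p: "1 \<le> p" and C: "0 \<le> C" and G: "integrable lborel G" "integrable lborel (\<lambda>x. norm (G x) powr p)"
    and e: "0 < e"
  shows "\<exists>d>0. \<forall>h k. h \<le> d \<longrightarrow> mollifier h k \<longrightarrow>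
    (\<integral>\<^sup>+x. ennreal (norm (G x) powr (p - 1) + C) * norm (convol k G x - G x) \<partial>lborel) \<le> ennreal e"
proof -
  have "\<exists>d>0. \<forall>z. norm z < d \<longrightarrow>
    (\<integral>\<^sup>+x. ennreal (norm (G x) powr (p - 1) + C) * norm (G (x - z) - G x) \<partial>lborel) \<le> ennreal e"
    by (rule Lp_weighted_translation_continuous[OF p C G e])
  then obtain d where d: "d > 0" "\<forall>z. norm z < d \<longrightarrow>
    (\<integral>\<^sup>+x. ennreal (norm (G x) powr (p - 1) + C) * norm (G (x - z) - G x) \<partial>lborel) \<le> ennreal e"
    by (elim exE conjE)
  have [measurable]: "G \<in> borel_measurable borel" using G by (auto dest: borel_measurable_integrable)
  show ?thesis
  proof (intro exI[of _ d] conjI allI impI)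
    fix h and k :: "real ^ 'n \<Rightarrow> real" assume h: "h \<le> d" and k: "mollifier h k"
    note [measurable] = mollifier_measurable[OF k]
    define w where "w x = ennreal (norm (G x) powr (p - 1) + C)" for x
    have [measurable]: "w \<in> borel_measurable borel" unfolding w_def by measurable
    have iG: "integrable lborel (\<lambda>z. k z *\<^sub>R G (x - z))" for x
    proof -
      obtain M where M: "0 \<le> M" "\<And>z. \<bar>k z\<bar> \<le> M" using mollifier_bounded[OF k] by blast
      have "integrable (distr lborel borel (\<lambda>z. x - z)) G" using G(1) by (simp add: lborel_distr_reflect)
      then have "integrable lborel (\<lambda>z. G (x - z))"
        by (rule integrable_distr[rotated]) measurable
      then have "integrable lborel (\<lambda>z. M *\<^sub>R G (x - z))" by (rule integrable_scaleR_right)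
      then show ?thesis
      proof (rule Bochner_Integration.integrable_bound)
        show "AE z in lborel. norm (k z *\<^sub>R G (x - z)) \<le> norm (M *\<^sub>R G (x - z))"
        proof (rule AE_I2)
          fix z
          have "\<bar>k z\<bar> * norm (G (x - z)) \<le> \<bar>M\<bar> * norm (G (x - z))"
            using M(1) M(2)[of z] by (intro mult_right_mono) auto
          then show "norm (k z *\<^sub>R G (x - z)) \<le> norm (M *\<^sub>R G (x - z))" by simp
        qed
      qed measurable
    qed
    have "(\<integral>\<^sup>+x. w x * norm (convol k G x - G x) \<partial>lborel)
      \<le> (\<integral>\<^sup>+x. w x * (\<integral>\<^sup>+z. ennreal (k z) * norm (G (x - z) - G x) \<partial>lborel) \<partial>lborel)"
      by (intro nn_integral_mono mult_left_mono norm_convol_diff_le[OF k iG]) auto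
    also have "\<dots> = (\<integral>\<^sup>+x. \<integral>\<^sup>+z. w x * (ennreal (k z) * norm (G (x - z) - G x)) \<partial>lborel \<partial>lborel)"
      by (intro nn_integral_cong nn_integral_cmult[symmetric]) auto
    also have "\<dots> = (\<integral>\<^sup>+z. \<integral>\<^sup>+x. w x * (ennreal (k z) * norm (G (x - z) - G x)) \<partial>lborel \<partial>lborel)"
    proof (rule lborel_pair.Fubini'[symmetric])
      have "(\<lambda>(x, z). w x * (ennreal (k z) * norm (G (x - z) - G x))) \<in> borel_measurable (borel \<Otimes>\<^sub>M borel)"
        by measurable
      then show "(\<lambda>(x, z). w x * (ennreal (k z) * norm (G (x - z) - G x))) \<in> borel_measurable (lborel \<Otimes>\<^sub>M lborel)"
        by (subst measurable_cong_sets[OF sets_pair_measure_cong[OF sets_lborel sets_lborel] refl])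
    qed
    also have "\<dots> = (\<integral>\<^sup>+z. ennreal (k z) * (\<integral>\<^sup>+x. w x * norm (G (x - z) - G x) \<partial>lborel) \<partial>lborel)"
    proof (rule nn_integral_cong)
      fix z
      have "(\<integral>\<^sup>+x. w x * (ennreal (k z) * norm (G (x - z) - G x)) \<partial>lborel)
        = (\<integral>\<^sup>+x. ennreal (k z) * (w x * norm (G (x - z) - G x)) \<partial>lborel)"
        by (simp add: mult.left_commute)
      also have "\<dots> = ennreal (k z) * (\<integral>\<^sup>+x. w x * norm (G (x - z) - G x) \<partial>lborel)"
        by (rule nn_integral_cmult) measurable
      finally show "(\<integral>\<^sup>+x. w x * (ennreal (k z) * norm (G (x - z) - G x)) \<partial>lborel)
        = ennreal (k z) * (\<integral>\<^sup>+x. w x * norm (G (x - z) - G x) \<partial>lborel)" .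
    qed
    also have "\<dots> \<le> (\<integral>\<^sup>+z. ennreal e * ennreal (k z) \<partial>lborel)"
    proof (rule nn_integral_mono)
      fix z
      show "ennreal (k z) * (\<integral>\<^sup>+x. w x * norm (G (x - z) - G x) \<partial>lborel) \<le> ennreal e * ennreal (k z)"
      proof (cases "norm z < h")
        case True
        then have "ennreal (k z) * (\<integral>\<^sup>+x. w x * norm (G (x - z) - G x) \<partial>lborel) \<le> ennreal (k z) * ennreal e"
          unfolding w_def using h by (intro mult_left_mono d(2)[rule_format]) auto
        then show ?thesis by (simp only: mult.commute[of "ennreal e"])
      qed (simp add: mollifier_eq_0[OF k])
    qed
    also have "\<dots> = ennreal e" using mollifier_nn_integral[OF k] by (simp add: nn_integral_cmult)
    finally show "(\<integral>\<^sup>+x. ennreal (norm (G x) powr (p - 1) + C) * norm (convol k G x - G x) \<partial>lborel) \<le> ennreal e"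
      unfolding w_def .
  qed (rule d(1))
qed

subsection \<open>The flux of the \<open>p\<close>-Laplacian and the barrier\<close>

definition flux :: "real \<Rightarrow> 'a::real_inner \<Rightarrow> 'a" where
  "flux p a = norm a powr (p - 2) *\<^sub>R a"

text \<open>This includes t = 0, where both sides vanish because \<open>0 powr s = 0\<close>; it
  saves case distinctions at zeros of the gradient.\<close>

lemma powr_minus_one_mult: "0 \<le> t \<Longrightarrow> t powr (s - 1) * t = t powr s" for t s :: real
  using powr_mult_base[of t "s - 1"] by (simp add: mult.commute)

lemma norm_flux: "norm (flux p a) = norm a powr (p - 1)"
  using powr_minus_one_mult[of "norm a" "p - 1"] by (simp add: flux_def)

lemma flux_inner_self: "flux p a \<bullet> a = norm a powr (p - 1) * norm a"
proof -
  have "flux p a \<bullet> a = (norm a powr (p - 2) * norm a) * norm a"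
    by (simp add: flux_def dot_square_norm power2_eq_square mult.assoc)
  then show ?thesis using powr_minus_one_mult[of "norm a" "p - 1"] by simp
qed

text \<open>Cauchy-Schwarz on the mixed terms reduces the claim to real numbers, where it is the
  monotonicity of t \<mapsto> t^(p-1).\<close>

lemma flux_monotone:
  assumes "1 \<le> p"
  shows "0 \<le> (flux p a - flux p b) \<bullet> (a - b)"
proof -
  have "flux p a \<bullet> b \<le> norm a powr (p - 1) * norm b" "flux p b \<bullet> a \<le> norm b powr (p - 1) * norm a"
    using norm_cauchy_schwarz[of "flux p a" b] norm_cauchy_schwarz[of "flux p b" a] by (auto simp: norm_flux)
  then have "(flux p a - flux p b) \<bullet> (a - b) \<ge> (norm a powr (p - 1) - norm b powr (p - 1)) * (norm a - norm b)"
    using flux_inner_self[of p a] flux_inner_self[of p b] by (simp add: inner_diff algebra_simps)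
  moreover have "(norm a powr (p - 1) - norm b powr (p - 1)) * (norm a - norm b) \<ge> 0"
    using assms powr_mono2[of "p - 1" "norm a" "norm b"] powr_mono2[of "p - 1" "norm b" "norm a"]
    by (cases "norm a \<le> norm b") (auto intro: mult_nonneg_nonneg mult_nonpos_nonpos)
  ultimately show ?thesis by linarith
qed

lemma tendsto_norm_powr_zero:
  "0 < s \<Longrightarrow> ((\<lambda>x::'a::real_normed_vector. norm x powr s) \<longlongrightarrow> 0) (at 0)"
  by (rule tendsto_zero_powrI[where b=s]) (auto intro!: tendsto_eq_intros)

text \<open>The barrier exponent lies between 1 and 2, so the scalar factor may be singular at the
  origin. The formula survives there: it evaluates to 0, and |h|^q / |h| tends to 0 because q >
  1.\<close>

lemma has_derivative_norm_powr:
  fixes x :: "'a::real_inner"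
  assumes q: "1 < q"
  shows "((\<lambda>x. norm x powr q) has_derivative (\<lambda>v. ((q * norm x powr (q - 2)) *\<^sub>R x) \<bullet> v)) (at x)"
proof (cases "x = 0")
  case True
  have "((\<lambda>h::'a. norm h powr (q - 1)) \<longlongrightarrow> 0) (at 0)"
    using q by (intro tendsto_norm_powr_zero) auto
  moreover have "\<forall>\<^sub>F h::'a in at 0. norm h powr (q - 1) = norm (norm h powr q) / norm h"
  proof (intro always_eventually allI)
    fix h :: 'a
    show "norm h powr (q - 1) = norm (norm h powr q) / norm h"
      using powr_minus_one_mult[of "norm h" q] by (cases "h = 0") (auto simp: field_simps)
  qed
  ultimately have "((\<lambda>h::'a. norm (norm h powr q) / norm h) \<longlongrightarrow> 0) (at 0)"
    by (rule Lim_transform_eventually)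
  then show ?thesis using True by (simp add: has_derivative_at inner_zero_left[abs_def])
next
  case False
  have "((\<lambda>t. t powr q) has_derivative (\<lambda>t. q * norm x powr (q - 1) * t)) (at (norm x))"
    using has_real_derivative_powr[of "norm x" q] False by (simp add: has_field_derivative_def)
  from has_derivative_compose[OF has_derivative_norm[OF False] this]
  have "((\<lambda>x. norm x powr q) has_derivative (\<lambda>v. q * norm x powr (q - 1) * (sgn x \<bullet> v))) (at x)"
    by (simp add: inner_commute)
  moreover have "q * norm x powr (q - 1) * (sgn x \<bullet> v) = ((q * norm x powr (q - 2)) *\<^sub>R x) \<bullet> v" for v
    using powr_minus_one_mult[of "norm x" "q - 1"] False by (simp add: sgn_div_norm field_simps)
  ultimately show ?thesis by simp
qed

text \<open>The exponent may be negative: the norm of the product is |x|^(s+1), which still tends to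
  0 at the origin. For the gradient of the barrier s is q - 2.\<close>

lemma continuous_norm_powr_scaleR:
  assumes "-1 < s"
  shows "continuous_on UNIV (\<lambda>x::'a::real_normed_vector. norm x powr s *\<^sub>R x)"
proof (rule continuous_at_imp_continuous_on, rule ballI)
  fix x :: 'a
  show "isCont (\<lambda>x. norm x powr s *\<^sub>R x) x"
  proof (cases "x = 0")
    case True
    have "((\<lambda>h::'a. norm h powr (s + 1)) \<longlongrightarrow> 0) (at 0)"
      using assms by (intro tendsto_norm_powr_zero) auto
    then have "((\<lambda>h::'a. norm (norm h powr s *\<^sub>R h)) \<longlongrightarrow> 0) (at 0)"
      by (subst (asm) powr_minus_one_mult[symmetric]) auto
    then have "((\<lambda>h::'a. norm h powr s *\<^sub>R h) \<longlongrightarrow> 0) (at 0)"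
      by (rule tendsto_norm_zero_cancel)
    then show ?thesis using True by (simp add: isCont_def)
  next
    case False
    then show ?thesis by (intro continuous_intros) auto
  qed
qed

text \<open>The barrier \<open>c|x - y|\<^sup>q\<close> with \<open>q = p/(p - 1)\<close>: its flux is linear, so that its
  \<open>p\<close>-Laplacian is the constant \<open>N (c q)\<^bsup>p - 1\<^esup>\<close>.\<close>

lemma flux_barrier:
  assumes p: "1 < p" and q: "q = p / (p - 1)" and c: "0 < c"
  shows "flux p ((c * q * norm z powr (q - 2)) *\<^sub>R z) = (c * q) powr (p - 1) *\<^sub>R z"
proof (cases "z = 0")
  case False
  have "0 < c * q" using p c by (simp add: q)
  define t where "t = norm z"
  have t: "t > 0" using False by (simp add: t_def)
  \<comment> \<open>This identity is equivalent to (q - 1)(p - 1) = 1 and singles out the exponent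
    q: all powers of |z| cancel and a linear field remains.\<close>
  have e: "(q - 1) * (p - 2) + (q - 2) = 0" using p by (simp add: q field_simps)
  have "norm ((c * q * t powr (q - 2)) *\<^sub>R z) = \<bar>c * q * t powr (q - 2)\<bar> * t"
    by (simp add: t_def)
  also have "\<dots> = c * q * (t powr (q - 2) * t)"
    using \<open>0 < c * q\<close> by (subst abs_of_nonneg) auto
  also have "\<dots> = c * q * t powr (q - 1)"
    using powr_minus_one_mult[of t "q - 1"] t by simp
  finally have n: "norm ((c * q * t powr (q - 2)) *\<^sub>R z) = c * q * t powr (q - 1)" .
  have "(c * q * t powr (q - 1)) powr (p - 2) * (c * q * t powr (q - 2))
      = ((c * q) powr (p - 2) * (c * q)) * (t powr ((q - 1) * (p - 2)) * t powr (q - 2))"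
    using \<open>0 < c * q\<close> t by (simp add: powr_mult powr_powr del: mult_pos_pos)
  also have "\<dots> = (c * q) powr (p - 1)"
    using powr_minus_one_mult[of "c * q" "p - 1"] \<open>0 < c * q\<close> t e by (simp flip: powr_add)
  finally show ?thesis unfolding flux_def t_def[symmetric] n by simp
qed (simp add: flux_def)

subsection \<open>Comparison and nondegeneracy\<close>

text \<open>Since t^(p-1) \<le> 1 + t^p for t \<ge> 0, integrability of |G|^p controls the lower
  power on a ball, where the constant 1 is integrable. It makes the flux integrable against
  compactly supported continuous fields.\<close>

lemma Lp_support_integrable:
  fixes G :: "'a::euclidean_space \<Rightarrow> 'b::{banach, second_countable_topology}"
  assumes p: "1 \<le> p" and G: "integrable lborel (\<lambda>x. norm (G x) powr p)"
    and [measurable]: "g \<in> borel_measurable borel" and M: "\<And>x. \<bar>g x\<bar> \<le> M * norm (G x) powr (p - 1) * indicator (cball a r) x"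
  shows "integrable lborel (g :: 'a \<Rightarrow> real)"
proof (rule Bochner_Integration.integrable_bound)
  show "integrable lborel (\<lambda>x. \<bar>M\<bar> * (indicator (cball a r) x + norm (G x) powr p))"
    using G by (intro integrable_mult_right Bochner_Integration.integrable_add integrable_real_indicator)
      (use emeasure_lborel_cball_finite in auto)
  show "AE x in lborel. norm (g x) \<le> norm (\<bar>M\<bar> * (indicator (cball a r) x + norm (G x) powr p))"
  proof (rule AE_I2)
    fix x
    have "norm (G x) powr (p - 1) \<le> 1 + norm (G x) powr p"
    proof (cases "norm (G x) \<le> 1")
      case True
      then have "norm (G x) powr (p - 1) \<le> 1 powr (p - 1)" using p by (intro powr_mono2) auto
      then show ?thesis by (simp add: add_increasing2)
    next
      case False
      then have "norm (G x) powr (p - 1) \<le> norm (G x) powr p" by (intro powr_mono) auto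
      then show ?thesis by simp
    qed
    then have "norm (G x) powr (p - 1) * indicator (cball a r) x \<le> indicator (cball a r) x + norm (G x) powr p"
      by (auto simp: indicator_def)
    moreover have "\<bar>g x\<bar> \<le> \<bar>M\<bar> * (norm (G x) powr (p - 1) * indicator (cball a r) x)"
      using M[of x] by (rule order_trans) (auto simp: indicator_def intro!: mult_right_mono)
    ultimately have "\<bar>g x\<bar> \<le> \<bar>M\<bar> * (indicator (cball a r) x + norm (G x) powr p)"
      by (meson abs_ge_zero mult_left_mono order_trans)
    then show "norm (g x) \<le> norm (\<bar>M\<bar> * (indicator (cball a r) x + norm (G x) powr p))"
      by (simp add: abs_mult)
  qed
qed (use assms in auto)

lemma convol_measurable:
  assumes k: "mollifier h k" and [measurable]: "f \<in> borel_measurable borel"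
  shows "convol k f \<in> borel_measurable borel"
proof -
  note [measurable] = mollifier_measurable[OF k]
  have "(\<lambda>(x, y). k (x - y) *\<^sub>R f y) \<in> borel_measurable (borel \<Otimes>\<^sub>M borel)"
    by measurable
  then have "(\<lambda>(x, y). k (x - y) *\<^sub>R f y) \<in> borel_measurable (borel \<Otimes>\<^sub>M lborel)"
    by (subst measurable_cong_sets[OF sets_pair_measure_cong[OF refl sets_lborel] refl])
  then have "(\<lambda>x. \<integral>y. k (x - y) *\<^sub>R f y \<partial>lborel) \<in> borel_measurable borel"
    by (rule lborel.borel_measurable_lebesgue_integral)
  then show ?thesis by (simp add: convol_def[abs_def])
qed

text \<open>Testing with \<open>((u\<^sub>h - \<Phi> - \<epsilon>)\<^sup>+)\<^sup>2\<close>, where \<open>u\<^sub>h\<close> is a mollification of \<open>u\<close>, keeps the test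
  function \<open>C\<^sup>1\<close>. Because \<open>K N < m\<close> is strict, the flux need not be strictly monotone.\<close>

lemma barrier_comparison:
  fixes u :: "real ^ 'n \<Rightarrow> real" and G b :: "real ^ 'n \<Rightarrow> real ^ 'n"
  assumes p: "2 \<le> p" and r: "0 < r" "r < R" and u: "continuous_on UNIV u"
    and G: "integrable lborel G" "integrable lborel (\<lambda>x. norm (G x) powr p)"
    and weak_grad: "\<And>\<phi> i. \<phi> \<in> C1_0 (ball x0 R) \<Longrightarrow>
       (\<integral>x. u x * grad \<phi> x $ i \<partial>lborel) = - (\<integral>x. G x $ i * \<phi> x \<partial>lborel)"
    and subsol: "\<And>\<phi>. \<phi> \<in> C1_0 (ball x0 R) \<Longrightarrow> (\<And>x. 0 \<le> \<phi> x) \<Longrightarrow> (\<And>x. \<phi> x \<noteq> 0 \<Longrightarrow> 0 < u x) \<Longrightarrow>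
       (\<integral>x. flux p (G x) \<bullet> grad \<phi> x \<partial>lborel) \<le> - m * (\<integral>x. \<phi> x \<partial>lborel)"
    and \<Phi>: "\<And>x. (\<Phi> has_derivative (\<lambda>v. b x \<bullet> v)) (at x)" "continuous_on UNIV b"
      "\<And>x. flux p (b x) = K *\<^sub>R (x - y)" "\<And>x. 0 \<le> \<Phi> x"
    and K: "K * real CARD('n) < m"
    and bdry: "\<And>x. x \<in> sphere x0 r \<Longrightarrow> u x < \<Phi> x"
    and x: "x \<in> ball x0 r"
  shows "u x \<le> \<Phi> x"
proof (rule ccontr)
  assume "\<not> u x \<le> \<Phi> x"
  \<comment> \<open>Four levels are kept apart: the excess is above 3 \<epsilon> near x, the test
    function is cut off at height \<epsilon>, mollification moves \<open>u\<close> by at most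
    \<epsilon>/2, and so the support of the test function lies where the excess of \<open>u\<close>
    itself is at least \<epsilon>/2.\<close>
  define \<epsilon> where "\<epsilon> = (u x - \<Phi> x) / 4"
  have \<epsilon>: "0 < \<epsilon>" "u x - \<Phi> x = 4 * \<epsilon>" using \<open>\<not> u x \<le> \<Phi> x\<close> by (auto simp: \<epsilon>_def)
  have c\<Phi>: "continuous_on UNIV \<Phi>"
    using \<Phi>(1) by (meson continuous_at_imp_continuous_on has_derivative_continuous)
  have [measurable]: "G \<in> borel_measurable borel" "b \<in> borel_measurable borel" "u \<in> borel_measurable borel"
    using G \<Phi>(2) u by (auto dest: borel_measurable_integrable intro: borel_measurable_continuous_onI)
  define S where "S = cball x0 r \<inter> {x. \<epsilon> / 2 \<le> u x - \<Phi> x}"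
  have S: "closed S" "compact S"
  proof -
    have "closed {x. \<epsilon> / 2 \<le> u x - \<Phi> x}" by (intro closed_Collect_le continuous_intros u c\<Phi>)
    then show "closed S" "compact S" unfolding S_def by (auto intro: compact_Int_closed)
  qed
  \<comment> \<open>The strict boundary inequality keeps the compact set \<open>S\<close> off the
    sphere, so the test function can be continued by zero.\<close>
  have S_ball: "S \<subseteq> ball x0 r"
  proof
    fix z assume z: "z \<in> S"
    show "z \<in> ball x0 r"
      using z bdry[of z] \<epsilon>(1) by (cases "dist x0 z = r") (auto simp: S_def)
  qed
  have "open (ball x0 r \<inter> {x. 3 * \<epsilon> < u x - \<Phi> x})"
    by (intro open_Int open_ball open_Collect_less continuous_intros u c\<Phi>)
  moreover have "x \<in> ball x0 r \<inter> {x. 3 * \<epsilon> < u x - \<Phi> x}" using x \<epsilon> by auto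
  ultimately obtain s where s0: "0 < s" "ball x s \<subseteq> ball x0 r \<inter> {x. 3 * \<epsilon> < u x - \<Phi> x}"
    unfolding open_contains_ball by blast
  then have s: "0 < s" "ball x s \<subseteq> ball x0 r" "\<And>z. z \<in> ball x s \<Longrightarrow> 3 * \<epsilon> < u z - \<Phi> z"
    by auto
  \<comment> \<open>A lower bound for the integral of the test function that does not depend on the
    mollification radius. The slack \<eta> derived from it is therefore fixed before that radius is
    chosen.\<close>
  define \<delta> where "\<delta> = \<epsilon>\<^sup>2 * measure lborel (ball x s)"
  have "0 < \<delta>" using \<epsilon>(1) content_ball_pos[OF s(1), of x] by (simp add: \<delta>_def)
  define \<eta> where "\<eta> = (m - K * real CARD('n)) * \<delta>"
  have "0 < \<eta>" using \<open>0 < \<delta>\<close> K by (simp add: \<eta>_def)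
  obtain B where B: "0 < B" "\<And>z. z \<in> cball x0 r \<Longrightarrow> \<bar>u z - \<Phi> z\<bar> \<le> B"
  proof -
    have "bounded ((\<lambda>z. u z - \<Phi> z) ` cball x0 r)"
      by (intro compact_imp_bounded compact_continuous_image continuous_intros compact_cball)
        (auto intro: continuous_on_subset u c\<Phi>)
    then show ?thesis using that unfolding bounded_pos by auto
  qed
  obtain C where C: "0 < C" "\<And>z. z \<in> cball x0 r \<Longrightarrow> norm (K *\<^sub>R (z - y)) \<le> C"
  proof -
    have "bounded ((\<lambda>z. K *\<^sub>R (z - y)) ` cball x0 r)"
      by (intro compact_imp_bounded compact_continuous_image continuous_intros compact_cball)
    then show ?thesis using that unfolding bounded_pos by auto
  qed
  have "\<exists>d>0. \<forall>h k. h \<le> d \<longrightarrow> mollifier h k \<longrightarrow> (\<forall>z\<in>cball x0 r. \<bar>convol k u z - u z\<bar> \<le> \<epsilon> / 2)"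
    by (rule convol_uniform_approx[OF u]) (use \<epsilon>(1) in auto)
  then obtain d1 where d1: "0 < d1"
    "\<forall>h k. h \<le> d1 \<longrightarrow> mollifier h k \<longrightarrow> (\<forall>z\<in>cball x0 r. \<bar>convol k u z - u z\<bar> \<le> \<epsilon> / 2)"
    by (elim exE conjE)
  have "1 \<le> p" using p by simp
  \<comment> \<open>The weight bounds the difference between the barrier flux, at most
    \<open>C\<close> on the ball, and the flux of \<open>G\<close>. The factor of the test gradient
    is at most 2 \<open>B\<close>, so the tolerance \<eta>/(4 B) leads to a total error of
    \<eta>/2.\<close>
  have "\<exists>d>0. \<forall>h k. h \<le> d \<longrightarrow> mollifier h k \<longrightarrow>
      (\<integral>\<^sup>+x. ennreal (norm (G x) powr (p - 1) + C) * norm (convol k G x - G x) \<partial>lborel) \<le> ennreal (\<eta> / (4 * B))"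
    by (rule Lp_weighted_convol_approx[OF \<open>1 \<le> p\<close> _ G]) (use C B \<open>0 < \<eta>\<close> in auto)
  then obtain d2 where d2: "0 < d2" "\<forall>h k. h \<le> d2 \<longrightarrow> mollifier h k \<longrightarrow>
      (\<integral>\<^sup>+x. ennreal (norm (G x) powr (p - 1) + C) * norm (convol k G x - G x) \<partial>lborel) \<le> ennreal (\<eta> / (4 * B))"
    by (elim exE conjE)
  \<comment> \<open>Three demands: uniform closeness of the mollification to \<open>u\<close>, a
    small weighted gradient error, and kernels centred in the small ball that stay inside the large
    one, where \<open>G\<close> is the weak gradient.\<close>
  define h where "h = min (min d1 d2) (R - r)"
  have h: "0 < h" "h \<le> d1" "h \<le> d2" "h \<le> R - r" using d1 d2 r by (auto simp: h_def)
  obtain k :: "real ^ 'n \<Rightarrow> real" where k: "mollifier h k" using mollifier_exists[OF h(1)] by blast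
  define U where "U = convol k u"
  define DU where "DU z = (\<integral>y. u y *\<^sub>R grad k (z - y) \<partial>lborel)" for z
  have U: "\<bar>U z - u z\<bar> \<le> \<epsilon> / 2" if "z \<in> cball x0 r" for z
    using d1(2)[rule_format, OF h(2) k that] by (simp add: U_def)
  have U1: "U z \<le> u z + \<epsilon> / 2" and U2: "u z \<le> U z + \<epsilon> / 2" if "z \<in> cball x0 r" for z
    using abs_le_D1[OF U[OF that]] abs_le_D2[OF U[OF that]] by linarith+
  have W: "(\<integral>\<^sup>+x. ennreal (norm (G x) powr (p - 1) + C) * norm (convol k G x - G x) \<partial>lborel) \<le> ennreal (\<eta> / (4 * B))"
    using d2(2) h(3) k by blast
  have dU: "(U has_derivative (\<lambda>v. DU z \<bullet> v)) (at z)" for z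
    unfolding U_def DU_def by (rule has_derivative_convol[OF k u])
  have cDU: "continuous_on UNIV DU"
    unfolding DU_def
    by (rule continuous_on_integral_kernel[OF mollifier_continuous_grad[OF k] mollifier_grad_eq_0[OF k] u])
  have DU: "DU z = convol k G z" if "z \<in> ball x0 r" for z
    unfolding DU_def
  proof (rule convol_gradient[OF k u G(1) weak_grad])
    show "cball z h \<subseteq> ball x0 R"
    proof
      fix w assume "w \<in> cball z h"
      then show "w \<in> ball x0 R" using that h(4) dist_triangle[of x0 w z] by auto
    qed
  qed
  have cU: "continuous_on UNIV U"
    using dU by (meson continuous_at_imp_continuous_on has_derivative_continuous)
  define \<phi> where "\<phi> z = (if z \<in> ball x0 r then (max 0 (U z - \<Phi> z - \<epsilon>))\<^sup>2 else 0)" for z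
  define g where "g z = (if z \<in> ball x0 r then (2 * max 0 (U z - \<Phi> z - \<epsilon>)) *\<^sub>R (DU z - b z) else 0)" for z
  have out: "max 0 (U z - \<Phi> z - \<epsilon>) = 0" if "z \<notin> S" "z \<in> ball x0 r" for z
    using that U1[of z] by (intro max_absorb1) (simp add: S_def)
  have \<phi>0: "\<phi> z = 0" and g0: "g z = 0" if "z \<notin> S" for z
    using out[OF that] by (auto simp: \<phi>_def g_def)
  \<comment> \<open>Both sets are open. The first carries the explicit formula and on the second
    everything vanishes, so the \<open>C\<^sup>1\<close> property can be checked on each
    separately.\<close>
  have cover: "z \<in> ball x0 r \<or> z \<in> - S" for z using S_ball by auto
  have d\<phi>: "(\<phi> has_derivative (\<lambda>v. g z \<bullet> v)) (at z)" for z
    using cover[of z]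
  proof
    assume z: "z \<in> ball x0 r"
    have "((\<lambda>z. (max 0 (U z - \<Phi> z - \<epsilon>))\<^sup>2) has_derivative (\<lambda>v. g z \<bullet> v)) (at z)"
      by (rule has_derivative_eq_rhs[OF has_derivative_compose[OF _
            has_real_derivative_pos_part_square[unfolded has_field_derivative_def]]])
        (use z in \<open>auto intro!: derivative_eq_intros dU \<Phi>(1) simp: g_def inner_diff_left\<close>)
    then show ?thesis
      by (rule has_derivative_transform_within_open[of _ _ _ _ "ball x0 r"]) (use z in \<open>auto simp: \<phi>_def\<close>)
  next
    assume z: "z \<in> - S"
    have "((\<lambda>z. 0) has_derivative (\<lambda>v. g z \<bullet> v)) (at z)" using z g0 by simp
    then show ?thesis
      by (rule has_derivative_transform_within_open[of _ _ _ _ "- S"]) (use z S \<phi>0 in auto)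
  qed
  have cg: "continuous_on UNIV g"
  proof -
    have "continuous_on (ball x0 r) g"
    proof (subst continuous_on_cong[OF refl])
      show "g z = (2 * max 0 (U z - \<Phi> z - \<epsilon>)) *\<^sub>R (DU z - b z)" if "z \<in> ball x0 r" for z
        using that by (simp add: g_def)
      show "continuous_on (ball x0 r) (\<lambda>z. (2 * max 0 (U z - \<Phi> z - \<epsilon>)) *\<^sub>R (DU z - b z))"
        by (rule continuous_on_subset[of UNIV]) (auto intro!: continuous_intros cU c\<Phi> cDU \<Phi>(2))
    qed
    moreover have "continuous_on (- S) g"
      by (subst continuous_on_cong[OF refl, of _ _ "\<lambda>_. 0"]) (auto simp: g0)
    ultimately have "continuous_on (ball x0 r \<union> - S) g"
      using S by (intro continuous_on_open_Un) auto
    also have "ball x0 r \<union> - S = UNIV" using cover by blast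
    finally show ?thesis .
  qed
  have C1: "Ck_on 1 UNIV \<phi>" using d\<phi> cg by (rule Ck_on_1_I)
  have gr: "grad \<phi> = g" using grad_eqI[OF d\<phi>] by blast
  have "{z. \<phi> z \<noteq> 0} \<subseteq> S" using \<phi>0 by auto
  then have "closure {z. \<phi> z \<noteq> 0} \<subseteq> S" using S by (intro closure_minimal) auto
  moreover have "S \<subseteq> ball x0 R" using S_ball r by auto
  moreover have "compact (closure {z. \<phi> z \<noteq> 0})"
    using \<open>closure {z. \<phi> z \<noteq> 0} \<subseteq> S\<close> S(2) by (metis closed_closure compact_Int_closed inf.absorb_iff2 inf.commute)
  ultimately have test: "\<phi> \<in> C1_0 (ball x0 R)"
    using C1 by (auto simp: C1_0_def compactly_contained_def simp del: Ck_on.simps One_nat_def)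
  have c\<phi>: "continuous_on UNIV \<phi>" using C1 by (rule Ck_on_1_continuous)
  have [measurable]: "g \<in> borel_measurable borel" "\<phi> \<in> borel_measurable borel"
    using cg c\<phi> by (auto intro: borel_measurable_continuous_onI)
  have i\<phi>: "integrable lborel \<phi>"
    using integrable_continuous_compact_support[OF c\<phi> S(2) \<phi>0] .
  have "bounded (g ` S)"
    using cg S by (intro compact_imp_bounded compact_continuous_image) (auto intro: continuous_on_subset)
  then obtain Mg where Mg: "\<And>z. z \<in> S \<Longrightarrow> norm (g z) \<le> Mg" by (auto simp: bounded_iff)
  have i1: "integrable lborel (\<lambda>z. flux p (G z) \<bullet> g z)"
  proof (rule Lp_support_integrable[OF \<open>1 \<le> p\<close> G(2)])
    show "(\<lambda>z. flux p (G z) \<bullet> g z) \<in> borel_measurable borel" unfolding flux_def by measurable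
    show "\<bar>flux p (G z) \<bullet> g z\<bar> \<le> Mg * norm (G z) powr (p - 1) * indicator (cball x0 r) z" for z
    proof (cases "z \<in> S")
      case True
      have "\<bar>flux p (G z) \<bullet> g z\<bar> \<le> norm (G z) powr (p - 1) * norm (g z)"
        using Cauchy_Schwarz_ineq2[of "flux p (G z)" "g z"] by (simp add: norm_flux)
      also have "\<dots> \<le> norm (G z) powr (p - 1) * Mg" using Mg[OF True] by (intro mult_left_mono) auto
      finally show ?thesis using True by (simp add: S_def mult.commute)
    next
      case False
      have "x \<in> S" using x \<epsilon> by (simp add: S_def)
      then have "0 \<le> Mg" using Mg[of x] norm_ge_zero[of "g x"] by linarith
      then have "0 \<le> Mg * norm (G z) powr (p - 1) * indicator (cball x0 r) z" by simp
      then show ?thesis using g0[OF False] by simp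
    qed
  qed
  have i2: "integrable lborel (\<lambda>z. (K *\<^sub>R (z - y)) \<bullet> g z)"
    by (rule integrable_continuous_compact_support[OF _ S(2)]) (auto intro!: continuous_intros cg simp: g0)
  \<comment> \<open>The barrier is nonnegative and \<open>u\<close> exceeds it on the support, so
    the test function only sees the positivity set, where the subsolution inequality is
    available.\<close>
  have "0 < u z" if "\<phi> z \<noteq> 0" for z
  proof -
    have "z \<in> S" using that \<phi>0 by auto
    then show ?thesis using \<Phi>(4)[of z] \<epsilon>(1) by (auto simp: S_def)
  qed
  then have e1: "(\<integral>z. flux p (G z) \<bullet> g z \<partial>lborel) \<le> - m * (\<integral>z. \<phi> z \<partial>lborel)"
    using subsol[OF test] gr by (simp add: \<phi>_def)
  have e2: "(\<integral>z. (K *\<^sub>R (z - y)) \<bullet> g z \<partial>lborel) = - K * real CARD('n) * (\<integral>z. \<phi> z \<partial>lborel)"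
    using integral_id_inner_grad[OF C1 S(2) \<phi>0, of y] gr by simp
  \<comment> \<open>The integral of \<open>f\<close> is estimated twice: from below by \<eta>
    through the two weak formulations, from above by \<eta>/2 through monotonicity and the gradient
    error.\<close>
  define f where "f z = (K *\<^sub>R (z - y) - flux p (G z)) \<bullet> g z" for z
  have iff: "integrable lborel f"
    unfolding f_def inner_diff_left using i1 i2 by (rule Bochner_Integration.integrable_diff[rotated])
  have [measurable]: "f \<in> borel_measurable borel" using iff by (auto dest: borel_measurable_integrable)
  have "\<delta> \<le> (\<integral>z. \<phi> z \<partial>lborel)"
  proof -
    have "\<delta> = (\<integral>z. \<epsilon>\<^sup>2 * indicator (ball x s) z \<partial>lborel)" by (simp add: \<delta>_def)
    also have "\<dots> \<le> (\<integral>z. \<phi> z \<partial>lborel)"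
    proof (rule integral_mono)
      show "integrable lborel (\<lambda>z. \<epsilon>\<^sup>2 * indicator (ball x s) z)"
        by (intro integrable_mult_right integrable_real_indicator) (use emeasure_lborel_ball_finite in auto)
      show "\<epsilon>\<^sup>2 * indicator (ball x s) z \<le> \<phi> z" for z
      proof (cases "z \<in> ball x s")
        case True
        then have z: "z \<in> ball x0 r" using s(2) by auto
        then have "\<epsilon> \<le> max 0 (U z - \<Phi> z - \<epsilon>)" using s(3)[OF True] U2[of z] \<epsilon>(1) by (intro max.coboundedI2) simp
        then have "\<epsilon>\<^sup>2 \<le> (max 0 (U z - \<Phi> z - \<epsilon>))\<^sup>2" using \<epsilon>(1) by (intro power_mono) auto
        then show ?thesis using z True by (simp add: \<phi>_def)
      qed (simp add: \<phi>_def)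
    qed (fact i\<phi>)
    finally show ?thesis .
  qed
  then have "\<eta> \<le> (m - K * real CARD('n)) * (\<integral>z. \<phi> z \<partial>lborel)"
    using K unfolding \<eta>_def by (intro mult_left_mono) auto
  also have "\<dots> \<le> (\<integral>z. f z \<partial>lborel)"
  proof -
    have "(\<integral>z. f z \<partial>lborel) = (\<integral>z. (K *\<^sub>R (z - y)) \<bullet> g z \<partial>lborel) - (\<integral>z. flux p (G z) \<bullet> g z \<partial>lborel)"
      unfolding f_def inner_diff_left using i2 i1 by (rule Bochner_Integration.integral_diff)
    then show ?thesis using e1 e2 by (simp add: algebra_simps)
  qed
  also have "\<dots> \<le> (\<integral>z. max 0 (f z) \<partial>lborel)"
    using iff by (intro integral_mono) auto
  also have "\<dots> \<le> \<eta> / 2"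
  proof -
    have "ennreal (\<integral>z. max 0 (f z) \<partial>lborel) = (\<integral>\<^sup>+z. max 0 (f z) \<partial>lborel)"
      using iff by (intro nn_integral_eq_integral[symmetric]) auto
    also have "\<dots> \<le> (\<integral>\<^sup>+z. ennreal (2 * B) * (ennreal (norm (G z) powr (p - 1) + C) * norm (convol k G z - G z)) \<partial>lborel)"
    proof (rule nn_integral_mono)
      fix z
      have "max 0 (f z) \<le> (2 * B) * ((norm (G z) powr (p - 1) + C) * norm (convol k G z - G z))"
      proof (cases "z \<in> ball x0 r")
        case True
        define \<tau> where "\<tau> = 2 * max 0 (U z - \<Phi> z - \<epsilon>)"
        have \<tau>: "0 \<le> \<tau>" "\<tau> \<le> 2 * B"
          using B(1) B(2)[of z] U1[of z] \<epsilon>(1) True by (auto simp: \<tau>_def abs_le_iff)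
        \<comment> \<open>The mollified gradient minus \<open>b\<close> is split as
          (\<open>convol k G - G\<close>) + (\<open>G - b\<close>). Against the flux difference the
          second part has a favourable sign by monotonicity, so only the mollification error
          remains.\<close>
        have "f z = \<tau> * ((K *\<^sub>R (z - y) - flux p (G z)) \<bullet> (convol k G z - G z)) - \<tau> * ((flux p (G z) - flux p (b z)) \<bullet> (G z - b z))"
          using True by (simp add: f_def g_def \<tau>_def DU \<Phi>(3) inner_diff algebra_simps)
        also have "\<dots> \<le> \<tau> * ((K *\<^sub>R (z - y) - flux p (G z)) \<bullet> (convol k G z - G z))"
          using \<tau>(1) flux_monotone[OF \<open>1 \<le> p\<close>, of "G z" "b z"] by simp
        also have "\<dots> \<le> \<tau> * ((norm (G z) powr (p - 1) + C) * norm (convol k G z - G z))"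
        proof (intro mult_left_mono \<tau>)
          have "norm (K *\<^sub>R (z - y) - flux p (G z)) \<le> norm (G z) powr (p - 1) + C"
            using C(2)[of z] True norm_triangle_ineq4[of "K *\<^sub>R (z - y)" "flux p (G z)"] by (simp add: norm_flux)
          then have "norm (K *\<^sub>R (z - y) - flux p (G z)) * norm (convol k G z - G z)
              \<le> (norm (G z) powr (p - 1) + C) * norm (convol k G z - G z)"
            by (rule mult_right_mono) simp
          then show "(K *\<^sub>R (z - y) - flux p (G z)) \<bullet> (convol k G z - G z)
              \<le> (norm (G z) powr (p - 1) + C) * norm (convol k G z - G z)"
            using norm_cauchy_schwarz by (rule order_trans[rotated])
        qed
        also have "\<dots> \<le> (2 * B) * ((norm (G z) powr (p - 1) + C) * norm (convol k G z - G z))"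
          using \<tau> C(1) by (intro mult_right_mono mult_nonneg_nonneg add_nonneg_nonneg) auto
        finally show ?thesis using B(1) C(1) by auto
      next
        case False
        then show ?thesis using B(1) C(1) by (simp add: f_def g_def)
      qed
      then show "ennreal (max 0 (f z)) \<le> ennreal (2 * B) * (ennreal (norm (G z) powr (p - 1) + C) * norm (convol k G z - G z))"
      proof (rule order_trans[OF ennreal_leI])
        have "0 \<le> norm (G z) powr (p - 1) + C" using C(1) by (intro add_nonneg_nonneg) auto
        then show "ennreal (2 * B * ((norm (G z) powr (p - 1) + C) * norm (convol k G z - G z)))
          \<le> ennreal (2 * B) * (ennreal (norm (G z) powr (p - 1) + C) * norm (convol k G z - G z))"
          using B(1) by (simp add: ennreal_mult del: ennreal_plus)
      qed
    qed
    also have "\<dots> = ennreal (2 * B) * (\<integral>\<^sup>+z. ennreal (norm (G z) powr (p - 1) + C) * norm (convol k G z - G z) \<partial>lborel)"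
      by (rule nn_integral_cmult) (use convol_measurable[OF k, of G] in measurable)
    also have "\<dots> \<le> ennreal (2 * B) * ennreal (\<eta> / (4 * B))"
      using W by (rule mult_left_mono) simp
    also have "\<dots> = ennreal (\<eta> / 2)"
      using B(1) \<open>0 < \<eta>\<close> by (simp flip: ennreal_mult)
    finally show ?thesis using \<open>0 < \<eta>\<close> by simp
  qed
  finally show False using \<open>0 < \<eta>\<close> by simp
qed

section \<open>Borel representatives and localisation to a ball\<close>

lemma borel_measurable_vec_component [measurable (raw)]:
  fixes f :: "'a \<Rightarrow> real ^ 'n"
  assumes "f \<in> borel_measurable M"
  shows "(\<lambda>x. f x $ i) \<in> borel_measurable M"
  using assms
  by (rule measurable_compose[OF _ borel_measurable_continuous_onI])
    (rule linear_continuous_on[OF bounded_linear_vec_nth])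

text \<open>Scalar representatives are chosen for the finitely many components and reassembled. A
  Borel representative is wanted because the convolution estimates use Tonelli on a Borel product
  space.\<close>

lemma ex_borel_measurable_AE_eq:
  fixes f :: "'a::euclidean_space \<Rightarrow> real ^ 'n"
  assumes "f \<in> borel_measurable lebesgue"
  shows "\<exists>g\<in>borel_measurable borel. AE x in lebesgue. f x = g x"
proof -
  have "\<forall>i. \<exists>g. g \<in> borel_measurable lborel \<and> (AE x in lborel. f x $ i = g x)"
    using completion_ex_borel_measurable_real[OF borel_measurable_vec_component[OF assms]] by fast
  from choice[OF this] obtain g where g: "\<forall>i. g i \<in> borel_measurable lborel \<and> (AE x in lborel. f x $ i = g i x)"
    by (elim exE)
  have "AE x in lborel. \<forall>i\<in>UNIV. f x $ i = g i x"
    using g by (intro AE_finite_allI) auto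
  then have "AE x in lborel. f x = (\<Sum>i\<in>UNIV. g i x *\<^sub>R axis i 1)"
  proof eventually_elim
    fix x assume "\<forall>i\<in>UNIV. f x $ i = g i x"
    then show "f x = (\<Sum>i\<in>UNIV. g i x *\<^sub>R axis i 1)"
      using basis_expansion[of "f x"] by (simp add: scalar_mult_eq_scaleR)
  qed
  then have "AE x in lebesgue. f x = (\<Sum>i\<in>UNIV. g i x *\<^sub>R axis i 1)" by (rule AE_completion)
  moreover have "(\<lambda>x. \<Sum>i\<in>UNIV. g i x *\<^sub>R axis i (1::real)) \<in> borel_measurable borel"
  proof -
    have "(\<lambda>x. g i x *\<^sub>R axis i (1::real)) \<in> borel_measurable borel" for i
      using g[rule_format, of i] by (intro borel_measurable_scaleR) auto
    then show ?thesis by (intro borel_measurable_sum)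
  qed
  ultimately show ?thesis by (rule bexI)
qed

text \<open>A ball that meets both the set and its complement meets the frontier by connectedness,
  which would put a frontier point within distance \<open>R\<close> of \<open>A\<close>.\<close>

lemma cball_subset_of_setdist_frontier:
  fixes \<Omega> :: "'a::euclidean_space set"
  assumes "x \<in> A" "A \<subseteq> \<Omega>" "0 \<le> R" "R < setdist A (frontier \<Omega>)"
  shows "cball x R \<subseteq> \<Omega>"
proof (rule ccontr)
  assume "\<not> cball x R \<subseteq> \<Omega>"
  then have "cball x R - \<Omega> \<noteq> {}" by auto
  moreover have "x \<in> cball x R \<inter> \<Omega>" using assms by auto
  ultimately have "cball x R \<inter> frontier \<Omega> \<noteq> {}" by (intro connected_Int_frontier) blast+
  then obtain w where "dist x w \<le> R" "w \<in> frontier \<Omega>" by auto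
  then show False using setdist_le_dist[of x A w "frontier \<Omega>"] assms by auto
qed

text \<open>Test functions supported in the ball cannot distinguish \<open>u\<close> from
  \<open>v\<close>, nor the gradient from its truncation to the ball or from a Borel representative.
  This turns the local Lebesgue formulation into the global Borel one used for comparison. The
  equation becomes an inequality by \<open>m \<le> lam x\<close> on the support of the test
  function, where the solution is positive.\<close>

lemma local_subsolution:
  fixes \<Omega> :: "(real ^ 'n) set"
  assumes p: "2 \<le> p" and \<Omega>: "open \<Omega>" and sol: "weak_solution p lam \<Omega> u"
    and lam: "lam \<in> borel_measurable (lebesgue_on \<Omega>)" "\<And>x. x \<in> \<Omega> \<Longrightarrow> m \<le> lam x" "\<And>x. x \<in> \<Omega> \<Longrightarrow> lam x \<le> M" "0 < m"
    and R: "0 < R" "cball x0 R \<subseteq> \<Omega>"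
    and v: "continuous_on UNIV v" "\<And>x. x \<in> cball x0 R \<Longrightarrow> v x = u x"
  obtains G where "integrable lborel G" "integrable lborel (\<lambda>x. norm (G x) powr p)"
    "\<And>\<phi> i. \<phi> \<in> C1_0 (ball x0 R) \<Longrightarrow> (\<integral>x. v x * grad \<phi> x $ i \<partial>lborel) = - (\<integral>x. G x $ i * \<phi> x \<partial>lborel)"
    "\<And>\<phi>. \<phi> \<in> C1_0 (ball x0 R) \<Longrightarrow> (\<And>x. 0 \<le> \<phi> x) \<Longrightarrow> (\<And>x. \<phi> x \<noteq> 0 \<Longrightarrow> 0 < v x) \<Longrightarrow>
       (\<integral>x. flux p (G x) \<bullet> grad \<phi> x \<partial>lborel) \<le> - m * (\<integral>x. \<phi> x \<partial>lborel)"
proof -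
  define B where "B = cball x0 R"
  have [measurable]: "B \<in> sets borel" "\<Omega> \<in> sets borel" using \<Omega> by (auto simp: B_def)
  have cu: "continuous_on \<Omega> u" using sol by (simp add: weak_solution_def)
  obtain G where G: "G \<in> Lp_loc p \<Omega>" and wg: "weak_gradient \<Omega> u G"
    and eq: "\<forall>\<phi>\<in>C1_0 \<Omega>. (LINT x:\<Omega>|lebesgue. flux p (G x) \<bullet> grad \<phi> x) =
           - (LINT x:\<Omega>|lebesgue. lam x * indicator {y\<in>\<Omega>. u y > 0} x * \<phi> x)"
    using sol unfolding weak_solution_def W1p_loc_gradient_def flux_def by (elim exE conjE)
  define H where "H x = indicator B x *\<^sub>R G x" for x
  \<comment> \<open>Measurability of the gradient is given relative to \<Omega> only; extension by
    zero carries it to the whole space before truncating to the ball.\<close>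
  define F where "F x = indicator \<Omega> x *\<^sub>R G x" for x
  have [measurable]: "B \<in> sets lebesgue" by simp
  have [measurable]: "F \<in> borel_measurable lebesgue"
    using G \<Omega> by (auto simp: Lp_loc_def borel_measurable_restrict_space_iff F_def[abs_def])
  have "H = (\<lambda>x. indicator B x *\<^sub>R F x)"
    using R by (auto simp: H_def F_def B_def indicator_def fun_eq_iff)
  then have mH [measurable]: "H \<in> borel_measurable lebesgue" by simp
  obtain G' where G': "G' \<in> borel_measurable borel" "AE x in lebesgue. H x = G' x"
    using ex_borel_measurable_AE_eq[OF mH] by blast
  have [measurable]: "G' \<in> borel_measurable borel" by fact
  have leb: "f \<in> borel_measurable lebesgue" if "f \<in> borel_measurable borel" for f :: "real ^ 'n \<Rightarrow> 'b::topological_space"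
    using that by (simp add: measurable_completion)
  have "integrable lebesgue (\<lambda>x. indicator B x *\<^sub>R (norm (G x) powr p))"
    using G R unfolding Lp_loc_def set_integrable_def B_def by auto
  also have "(\<lambda>x. indicator B x *\<^sub>R (norm (G x) powr p)) = (\<lambda>x. norm (H x) powr p)"
    by (auto simp: H_def indicator_def)
  finally have iHp: "integrable lebesgue (\<lambda>x. norm (H x) powr p)" .
  also have "integrable lebesgue (\<lambda>x. norm (H x) powr p) = integrable lebesgue (\<lambda>x. norm (G' x) powr p)"
  proof (rule integrable_cong_AE)
    show "AE x in lebesgue. norm (H x) powr p = norm (G' x) powr p"
      using G'(2) by eventually_elim simp
    show "(\<lambda>x. norm (G' x) powr p) \<in> borel_measurable lebesgue" by (rule leb) measurable
  qed measurable
  finally have iGp: "integrable lborel (\<lambda>x. norm (G' x) powr p)"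
    by (subst (asm) integrable_completion) auto
  \<comment> \<open>On a set of finite measure the p-th power controls the first: |H| is at most 1
    on the ball or at most |H|^p.\<close>
  have "integrable lebesgue H"
  proof (rule Bochner_Integration.integrable_bound)
    have "emeasure lebesgue B < \<infinity>"
      unfolding B_def using emeasure_lborel_cball_finite[of x0 R] by simp
    then show "integrable lebesgue (\<lambda>x. indicator B x + norm (H x) powr p)"
      by (intro Bochner_Integration.integrable_add iHp integrable_real_indicator) auto
    show "AE x in lebesgue. norm (H x) \<le> norm (indicator B x + norm (H x) powr p)"
    proof (rule AE_I2)
      fix x
      have "norm (H x) \<le> norm (H x) powr p" if "1 \<le> norm (H x)"
        using powr_mono[of 1 p "norm (H x)"] that p by simp
      then have "norm (H x) \<le> indicator B x + norm (H x) powr p"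
        by (cases "x \<in> B"; cases "1 \<le> norm (H x)") (auto simp: H_def add_increasing2)
      then show "norm (H x) \<le> norm (indicator B x + norm (H x) powr p)" by simp
    qed
  qed (fact mH)
  then have "integrable lebesgue G'"
    using integrable_cong_AE[OF mH leb[OF G'(1)] G'(2)] by simp
  then have iG: "integrable lborel G'" by (subst (asm) integrable_completion) auto
  have supp: "\<phi> \<in> C1_0 \<Omega>" "Ck_on 1 UNIV \<phi>" "x \<notin> B \<Longrightarrow> \<phi> x = 0" "x \<notin> B \<Longrightarrow> grad \<phi> x = 0"
    if "\<phi> \<in> C1_0 (ball x0 R)" for \<phi> :: "real ^ 'n \<Rightarrow> real" and x
  proof -
    have cl: "closure {x. \<phi> x \<noteq> 0} \<subseteq> ball x0 R"
      using that by (simp add: C1_0_def compactly_contained_def)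
    then have "closure {x. \<phi> x \<noteq> 0} \<subseteq> \<Omega>" using R(2) ball_subset_cball by blast
    then show "\<phi> \<in> C1_0 \<Omega>" "Ck_on 1 UNIV \<phi>"
      using that by (auto simp: C1_0_def compactly_contained_def)
    have "closure {x. \<phi> x \<noteq> 0} \<subseteq> B" using cl ball_subset_cball unfolding B_def by blast
    then show "x \<notin> B \<Longrightarrow> \<phi> x = 0" "x \<notin> B \<Longrightarrow> grad \<phi> x = 0"
      using closure_subset[of "{x. \<phi> x \<noteq> 0}"] grad_eq_0_outside[of x \<phi>] by auto
  qed
  have B\<Omega>: "x \<in> B \<Longrightarrow> x \<in> \<Omega>" for x using R by (auto simp: B_def)
  have [measurable]: "v \<in> borel_measurable borel" using v(1) by (rule borel_measurable_continuous_onI)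
  show ?thesis
  proof (rule that[OF iG iGp])
    fix \<phi> :: "real ^ 'n \<Rightarrow> real" and i assume \<phi>: "\<phi> \<in> C1_0 (ball x0 R)"
    note s = supp[OF \<phi>]
    have m\<phi> [measurable]: "\<phi> \<in> borel_measurable borel" "grad \<phi> \<in> borel_measurable borel"
      using Ck_on_1_continuous[OF s(2)] Ck_on_1_continuous_grad[OF s(2)] by (auto intro: borel_measurable_continuous_onI)
    note leb[OF m\<phi>(1), measurable] leb[OF m\<phi>(2), measurable]
    have "(\<integral>x. v x * grad \<phi> x $ i \<partial>lborel) = (\<integral>x. v x * grad \<phi> x $ i \<partial>lebesgue)"
      by (rule integral_completion[symmetric]) measurable
    also have "\<dots> = (LINT x:\<Omega>|lebesgue. u x * grad \<phi> x $ i)"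
      unfolding set_lebesgue_integral_def
    proof (rule Bochner_Integration.integral_cong)
      show "v x * grad \<phi> x $ i = indicat_real \<Omega> x *\<^sub>R (u x * grad \<phi> x $ i)" for x
        using s(4)[of x] B\<Omega>[of x] v(2)[of x] by (cases "x \<in> B") (auto simp: B_def)
    qed simp
    also have "\<dots> = - (LINT x:\<Omega>|lebesgue. G x $ i * \<phi> x)"
      using wg s(1) by (simp add: weak_gradient_def)
    also have "(LINT x:\<Omega>|lebesgue. G x $ i * \<phi> x) = (\<integral>x. H x $ i * \<phi> x \<partial>lebesgue)"
      unfolding set_lebesgue_integral_def
    proof (rule Bochner_Integration.integral_cong)
      show "indicat_real \<Omega> x *\<^sub>R (G x $ i * \<phi> x) = H x $ i * \<phi> x" for x
        using s(3)[of x] B\<Omega>[of x] by (cases "x \<in> B") (auto simp: H_def)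
    qed simp
    also have "\<dots> = (\<integral>x. G' x $ i * \<phi> x \<partial>lebesgue)"
    proof (rule integral_cong_AE)
      show "AE x in lebesgue. H x $ i * \<phi> x = G' x $ i * \<phi> x"
        using G'(2) by eventually_elim simp
      show "(\<lambda>x. G' x $ i * \<phi> x) \<in> borel_measurable lebesgue" by (rule leb) measurable
    qed measurable
    also have "\<dots> = (\<integral>x. G' x $ i * \<phi> x \<partial>lborel)"
      by (rule integral_completion) measurable
    finally show "(\<integral>x. v x * grad \<phi> x $ i \<partial>lborel) = - (\<integral>x. G' x $ i * \<phi> x \<partial>lborel)" .
  next
    fix \<phi> :: "real ^ 'n \<Rightarrow> real"
    assume \<phi>: "\<phi> \<in> C1_0 (ball x0 R)" and \<phi>0: "\<And>x. 0 \<le> \<phi> x" and \<phi>v: "\<And>x. \<phi> x \<noteq> 0 \<Longrightarrow> 0 < v x"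
    note s = supp[OF \<phi>]
    have m\<phi> [measurable]: "\<phi> \<in> borel_measurable borel" "grad \<phi> \<in> borel_measurable borel"
      using Ck_on_1_continuous[OF s(2)] Ck_on_1_continuous_grad[OF s(2)] by (auto intro: borel_measurable_continuous_onI)
    note leb[OF m\<phi>(1), measurable] leb[OF m\<phi>(2), measurable]
    have i\<phi>: "integrable lebesgue \<phi>"
      using integrable_continuous_compact_support[OF Ck_on_1_continuous[OF s(2)], of B] s(3)
      by (subst integrable_completion) (auto simp: B_def)
    have [measurable]: "(flux p :: real ^ 'n \<Rightarrow> real ^ 'n) \<in> borel_measurable borel"
      unfolding flux_def[abs_def] by measurable
    have "(\<integral>x. flux p (G' x) \<bullet> grad \<phi> x \<partial>lborel) = (\<integral>x. flux p (G' x) \<bullet> grad \<phi> x \<partial>lebesgue)"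
      by (rule integral_completion[symmetric]) measurable
    also have "\<dots> = (\<integral>x. flux p (H x) \<bullet> grad \<phi> x \<partial>lebesgue)"
    proof (rule integral_cong_AE)
      show "AE x in lebesgue. flux p (G' x) \<bullet> grad \<phi> x = flux p (H x) \<bullet> grad \<phi> x"
        using G'(2) by eventually_elim simp
      show "(\<lambda>x. flux p (G' x) \<bullet> grad \<phi> x) \<in> borel_measurable lebesgue" by (rule leb) measurable
    qed measurable
    also have "\<dots> = (LINT x:\<Omega>|lebesgue. flux p (G x) \<bullet> grad \<phi> x)"
      unfolding set_lebesgue_integral_def
    proof (rule Bochner_Integration.integral_cong)
      show "flux p (H x) \<bullet> grad \<phi> x = indicat_real \<Omega> x *\<^sub>R (flux p (G x) \<bullet> grad \<phi> x)" for x
        using s(4)[of x] B\<Omega>[of x] by (cases "x \<in> B") (auto simp: H_def)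
    qed simp
    also have "\<dots> = - (LINT x:\<Omega>|lebesgue. lam x * indicator {y\<in>\<Omega>. u y > 0} x * \<phi> x)"
      by (rule eq[rule_format, OF s(1)])
    also have "\<dots> \<le> - (\<integral>x. m * \<phi> x \<partial>lebesgue)"
      unfolding set_lebesgue_integral_def neg_le_iff_le
    proof (rule integral_mono)
      define P where "P = {y \<in> \<Omega>. u y > 0}"
      have "open P" unfolding P_def using continuous_open_preimage[OF cu \<Omega> open_greaterThan[of 0]]
        by (simp add: vimage_def Int_def)
      have [measurable]: "P \<in> sets lebesgue" using \<open>open P\<close> by simp
      have mlam: "(\<lambda>x. indicator \<Omega> x *\<^sub>R lam x) \<in> borel_measurable lebesgue"
        using lam(1) \<Omega> by (simp add: borel_measurable_restrict_space_iff)
      \<comment> \<open>The upper bound on \<open>lam\<close> enters here. Integrability has to be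
        secured first, since the integral of a nonintegrable function is 0 by convention and would
        not respect the pointwise inequality.\<close>
      have "integrable lebesgue (\<lambda>x. (indicator \<Omega> x *\<^sub>R lam x) * (indicator P x * \<phi> x))"
      proof (rule Bochner_Integration.integrable_bound)
        show "integrable lebesgue (\<lambda>x. M * \<phi> x)" using i\<phi> by simp
        show "(\<lambda>x. (indicator \<Omega> x *\<^sub>R lam x) * (indicator P x * \<phi> x)) \<in> borel_measurable lebesgue"
          by (intro borel_measurable_times mlam) measurable
        show "AE x in lebesgue. norm ((indicator \<Omega> x *\<^sub>R lam x) * (indicator P x * \<phi> x)) \<le> norm (M * \<phi> x)"
        proof (rule AE_I2)
          fix x
          show "norm ((indicator \<Omega> x *\<^sub>R lam x) * (indicator P x * \<phi> x)) \<le> norm (M * \<phi> x)"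
            using lam(2)[of x] lam(3)[of x] \<open>0 < m\<close>
            by (cases "x \<in> \<Omega>"; cases "x \<in> P") (auto simp: abs_mult intro!: mult_right_mono)
        qed
      qed
      then show "integrable lebesgue (\<lambda>x. indicat_real \<Omega> x *\<^sub>R (lam x * indicator {y \<in> \<Omega>. u y > 0} x * \<phi> x))"
        by (simp add: P_def mult.assoc)
      show "m * \<phi> x \<le> indicat_real \<Omega> x *\<^sub>R (lam x * indicator {y \<in> \<Omega>. u y > 0} x * \<phi> x)" for x
      proof (cases "\<phi> x = 0")
        case False
        then have "x \<in> B" "0 < v x" using s(3)[of x] \<phi>v[of x] by auto
        then have "x \<in> \<Omega>" "0 < u x" using B\<Omega> v(2) by (auto simp: B_def)
        then show ?thesis using mult_right_mono[OF lam(2) \<phi>0[of x]] by simp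
      qed simp
    qed (use i\<phi> in auto)
    also have "(\<integral>x. m * \<phi> x \<partial>lebesgue) = m * (\<integral>x. \<phi> x \<partial>lborel)"
      by (simp add: integral_completion)
    finally show "(\<integral>x. flux p (G' x) \<bullet> grad \<phi> x \<partial>lborel) \<le> - m * (\<integral>x. \<phi> x \<partial>lborel)" by simp
  qed
qed

section \<open>The nondegeneracy constant and the growth estimate\<close>

text \<open>The solution c of N (c q)^(p-1) = m/2 with q = p/(p-1), so that the barrier has
  p-Laplacian m/2. The factor 2 provides the strict inequality that the comparison consumes.\<close>

definition growth_const :: "nat \<Rightarrow> real \<Rightarrow> real \<Rightarrow> real" where
  "growth_const N p m = (m / (2 * real N)) powr (1 / (p - 1)) / (p / (p - 1))"

lemma nondegeneracy:
  fixes \<Omega> :: "(real ^ 'n) set"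
  assumes p: "2 \<le> p" and \<Omega>: "open \<Omega>" and sol: "weak_solution p lam \<Omega> u"
    and lam: "lam \<in> borel_measurable (lebesgue_on \<Omega>)" "\<And>x. x \<in> \<Omega> \<Longrightarrow> m \<le> lam x" "\<And>x. x \<in> \<Omega> \<Longrightarrow> lam x \<le> M" "0 < m"
    and R: "0 < r" "r < R" "cball x0 R \<subseteq> \<Omega>" and x0: "x0 \<in> closure {x \<in> \<Omega>. u x > 0}"
  shows "growth_const CARD('n) p m * r powr (p / (p - 1)) \<le> (SUP x\<in>sphere x0 r. u x)"
proof (rule ccontr)
  define q where "q = p / (p - 1)"
  define c where "c = growth_const CARD('n) p m"
  define \<sigma> where "\<sigma> = (SUP x\<in>sphere x0 r. u x)"
  assume "\<not> growth_const CARD('n) p m * r powr (p / (p - 1)) \<le> (SUP x\<in>sphere x0 r. u x)"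
  then have \<sigma>: "\<sigma> < c * r powr q" by (simp add: c_def q_def \<sigma>_def)
  have q: "1 < q" using p by (simp add: q_def field_simps)
  have c: "0 < c" using p lam(4) by (simp add: c_def growth_const_def)
  have "c * q = (m / (2 * real CARD('n))) powr (1 / (p - 1))"
    using p by (simp add: c_def growth_const_def q_def)
  then have K: "(c * q) powr (p - 1) = m / (2 * real CARD('n))"
    using p lam(4) by (simp add: powr_powr)
  have cu: "continuous_on \<Omega> u" using sol by (simp add: weak_solution_def)
  define B where "B = cball x0 R"
  \<comment> \<open>Composition with the nearest-point projection extends the restriction of
    \<open>u\<close> to the ball continuously to the whole space.\<close>
  define v where "v = u \<circ> closest_point B"
  have B: "convex B" "closed B" "B \<noteq> {}" "B \<subseteq> \<Omega>" using R by (auto simp: B_def)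
  have v: "continuous_on UNIV v"
    unfolding v_def
  proof (rule continuous_on_compose)
    show "continuous_on UNIV (closest_point B)" by (rule continuous_on_closest_point[OF B(1-3)])
    show "continuous_on (closest_point B ` UNIV) u"
      using B closest_point_in_set[OF B(2,3)] by (intro continuous_on_subset[OF cu]) auto
  qed
  have vu: "v x = u x" if "x \<in> cball x0 R" for x
    using that by (simp add: v_def closest_point_self B_def)
  have sphere: "sphere x0 r \<subseteq> cball x0 R" using R by auto
  have "bdd_above (u ` sphere x0 r)"
    using sphere R by (intro bounded_imp_bdd_above compact_imp_bounded compact_continuous_image continuous_on_subset[OF cu]) auto
  then have u\<sigma>: "u x \<le> \<sigma>" if "x \<in> sphere x0 r" for x
    unfolding \<sigma>_def using that by (rule cSUP_upper[rotated])
  \<comment> \<open>A barrier centred at distance t from \<open>x0\<close> is at least c (r - t)^q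
    on the sphere. By continuity the assumed strict inequality survives for small t, which leaves
    room to move the centre.\<close>
  have "((\<lambda>t. c * (r - t) powr q) \<longlongrightarrow> c * r powr q) (at 0)"
    using R(1) by (auto intro!: tendsto_eq_intros)
  then have "\<forall>\<^sub>F t in at 0. \<sigma> < c * (r - t) powr q"
    using \<sigma> by (rule order_tendstoD)
  then obtain d where d: "0 < d" "\<And>t. t \<noteq> 0 \<Longrightarrow> \<bar>t\<bar> < d \<Longrightarrow> \<sigma> < c * (r - t) powr q"
    unfolding eventually_at by (auto simp: dist_real_def)
  \<comment> \<open>The centre must be a point of strict positivity, whereas \<open>x0\<close> is
    only a limit of such points and \<open>u\<close> may vanish there.\<close>
  obtain y where y: "y \<in> \<Omega>" "0 < u y" "dist y x0 < min d r"
    using x0 d(1) R(1) unfolding closure_approachable by (metis (mono_tags, lifting) mem_Collect_eq min_less_iff_conj)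
  define \<Phi> where "\<Phi> x = c * norm (x - y) powr q" for x
  define b where "b x = (c * q * norm (x - y) powr (q - 2)) *\<^sub>R (x - y)" for x
  obtain G where G: "integrable lborel G" "integrable lborel (\<lambda>x. norm (G x) powr p)"
    "\<And>\<phi> i. \<phi> \<in> C1_0 (ball x0 R) \<Longrightarrow> (\<integral>x. v x * grad \<phi> x $ i \<partial>lborel) = - (\<integral>x. G x $ i * \<phi> x \<partial>lborel)"
    "\<And>\<phi>. \<phi> \<in> C1_0 (ball x0 R) \<Longrightarrow> (\<And>x. 0 \<le> \<phi> x) \<Longrightarrow> (\<And>x. \<phi> x \<noteq> 0 \<Longrightarrow> 0 < v x) \<Longrightarrow>
       (\<integral>x. flux p (G x) \<bullet> grad \<phi> x \<partial>lborel) \<le> - m * (\<integral>x. \<phi> x \<partial>lborel)"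
    by (rule local_subsolution[OF p \<Omega> sol lam _ R(3) v vu]) (use R in auto)
  have yb: "y \<in> ball x0 r" using y(3) by (simp add: dist_commute)
  have "v y \<le> \<Phi> y"
  proof (rule barrier_comparison[OF p R(1,2) v G])
    show "(\<Phi> has_derivative (\<lambda>w. b x \<bullet> w)) (at x)" for x
    proof -
      have "((\<lambda>x. norm (x - y) powr q) has_derivative (\<lambda>w. ((q * norm (x - y) powr (q - 2)) *\<^sub>R (x - y)) \<bullet> w)) (at x)"
        by (rule has_derivative_compose[OF _ has_derivative_norm_powr[OF q]]) (auto intro!: derivative_eq_intros)
      then have "(\<Phi> has_derivative (\<lambda>w. c * (((q * norm (x - y) powr (q - 2)) *\<^sub>R (x - y)) \<bullet> w))) (at x)"
        unfolding \<Phi>_def by (rule has_derivative_mult_right)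
      then show ?thesis by (simp add: b_def mult.assoc)
    qed
    have "continuous_on UNIV (\<lambda>x. norm (x - y) powr (q - 2) *\<^sub>R (x - y))"
      using q by (intro continuous_on_compose2[OF continuous_norm_powr_scaleR[of "q - 2"]] continuous_intros) auto
    then have "continuous_on UNIV (\<lambda>x. (c * q) *\<^sub>R (norm (x - y) powr (q - 2) *\<^sub>R (x - y)))"
      by (rule continuous_on_scaleR[OF continuous_on_const])
    then show "continuous_on UNIV b" by (simp add: b_def[abs_def])
    show "flux p (b x) = (m / (2 * real CARD('n))) *\<^sub>R (x - y)" for x
      using flux_barrier[OF _ q_def c, of "x - y"] p by (simp add: b_def K)
    show "0 \<le> \<Phi> x" for x using c by (simp add: \<Phi>_def)
    show "m / (2 * real CARD('n)) * real CARD('n) < m" using lam(4) by simp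
    show "v x < \<Phi> x" if x: "x \<in> sphere x0 r" for x
    proof -
      define t where "t = dist y x0"
      have t: "0 \<le> t" "t < d" "t < r" using y(3) by (auto simp: t_def)
      \<comment> \<open>The limit at 0 says nothing about t = 0 itself, that is
        \<open>y = x0\<close>; that case is the original assumption.\<close>
      have "\<sigma> < c * (r - t) powr q" using d(2)[of t] t \<sigma> by (cases "t = 0") auto
      also have "r - t \<le> norm (x - y)"
        using x dist_triangle[of x0 x y] by (auto simp: t_def dist_norm norm_minus_commute)
      then have "c * (r - t) powr q \<le> \<Phi> x"
        unfolding \<Phi>_def using c t q by (intro mult_left_mono powr_mono2) auto
      finally show ?thesis using u\<sigma>[OF x] vu[of x] sphere x by auto
    qed
  qed (use yb in blast)+
  \<comment> \<open>At its centre the barrier is \<open>0 powr q = 0\<close>, whereas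
    \<open>u y\<close> is positive.\<close>
  then show False using y(2) vu[of y] yb R by (simp add: \<Phi>_def)
qed

theorem theorem1p1:
  shows "\<exists>C\<^sub>0 :: real \<Rightarrow> real \<Rightarrow> real.
    (\<forall>p m. 2 \<le> p \<and> 0 < m \<longrightarrow> 0 < C\<^sub>0 p m) \<and>
    (\<forall>(p::real) (\<Omega> :: (real ^ 'n) set) (lam :: real ^ 'n \<Rightarrow> real) (g :: real ^ 'n \<Rightarrow> real)
        (u :: real ^ 'n \<Rightarrow> real) (\<Omega>' :: (real ^ 'n) set) (x\<^sub>0 :: real ^ 'n) (r::real).
       2 \<le> p \<and>
       bounded \<Omega> \<and> regular_domain \<Omega> \<and>
       lam \<in> borel_measurable (lebesgue_on \<Omega>) \<and>
       (\<exists>c>0. \<forall>x\<in>\<Omega>. c \<le> lam x) \<and> (\<exists>M. \<forall>x\<in>\<Omega>. lam x \<le> M) \<and>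
       continuous_on (frontier \<Omega>) g \<and>
       weak_solution p lam \<Omega> u \<and> bounded (u ` \<Omega>) \<and> attains_boundary_values \<Omega> u g \<and>
       \<Omega>' \<Subset> \<Omega> \<and> x\<^sub>0 \<in> closure {x\<in>\<Omega>. u x > 0} \<inter> \<Omega>' \<and>
       0 < r \<and> r < min 1 (setdist \<Omega>' (frontier \<Omega>)) \<longrightarrow>
       (SUP x\<in>sphere x\<^sub>0 r. u x) \<ge> C\<^sub>0 p (INF x\<in>\<Omega>. lam x) * r powr (p / (p - 1)))"
\<comment> \<open>The witness is fixed before the domain, the coefficient and the solution; the
  dimension enters through the type alone.\<close>
proof (rule exI[of _ "growth_const CARD('n)"], intro conjI allI impI; (elim conjE)?)
  show "0 < growth_const CARD('n) p m" if "2 \<le> p" "0 < m" for p m :: real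
    using that by (simp add: growth_const_def)
next
  fix p r :: real and \<Omega> \<Omega>' :: "(real ^ 'n) set" and lam u g :: "real ^ 'n \<Rightarrow> real" and x\<^sub>0 :: "real ^ 'n"
  assume p: "2 \<le> p" and \<Omega>: "regular_domain \<Omega>" and lam: "lam \<in> borel_measurable (lebesgue_on \<Omega>)"
    "\<exists>c>0. \<forall>x\<in>\<Omega>. c \<le> lam x" "\<exists>M. \<forall>x\<in>\<Omega>. lam x \<le> M"
    and sol: "weak_solution p lam \<Omega> u" and \<Omega>': "\<Omega>' \<Subset> \<Omega>" and x0: "x\<^sub>0 \<in> closure {x\<in>\<Omega>. u x > 0} \<inter> \<Omega>'"
    and r: "0 < r" "r < min 1 (setdist \<Omega>' (frontier \<Omega>))"
  have ne: "\<Omega> \<noteq> {}" "open \<Omega>" using \<Omega> by (auto simp: regular_domain_def)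
  obtain c M where c: "0 < c" "\<And>x. x \<in> \<Omega> \<Longrightarrow> c \<le> lam x" and M: "\<And>x. x \<in> \<Omega> \<Longrightarrow> lam x \<le> M"
    using lam by blast
  have "c \<le> (INF x\<in>\<Omega>. lam x)" using ne c by (intro cINF_greatest)
  then have "0 < (INF x\<in>\<Omega>. lam x)" using c(1) by linarith
  have inf: "(INF x\<in>\<Omega>. lam x) \<le> lam x" if "x \<in> \<Omega>" for x
    using that c by (intro cINF_lower bdd_belowI2)
  \<comment> \<open>The midpoint leaves space on both sides: the closed ball of radius
    \<open>R\<close> stays inside the domain, and \<open>R - r\<close> is room for
    mollification.\<close>
  define R where "R = (r + setdist \<Omega>' (frontier \<Omega>)) / 2"
  have R: "r < R" "R < setdist \<Omega>' (frontier \<Omega>)" using r by (auto simp: R_def)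
  have "\<Omega>' \<subseteq> \<Omega>" using \<Omega>' closure_subset[of \<Omega>'] by (auto simp: compactly_contained_def)
  then have "cball x\<^sub>0 R \<subseteq> \<Omega>"
    using x0 R r by (intro cball_subset_of_setdist_frontier[of _ \<Omega>']) auto
  then show "growth_const CARD('n) p (INF x\<in>\<Omega>. lam x) * r powr (p / (p - 1)) \<le> (SUP x\<in>sphere x\<^sub>0 r. u x)"
    using nondegeneracy[OF p ne(2) sol lam(1) inf M \<open>0 < (INF x\<in>\<Omega>. lam x)\<close> r(1) R(1)] x0 by auto
qed

end
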